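(* Let $A,B\in\mathcal{M}_n$ be accretive matrices, and let $\sigma$ be the matrix mean characterized by a matrix monotone function $f:(0,\infty)\to(0,\infty)$ with $f(1)=1$. Let $\nu_f$ be the probability measure on $[0,1]$ associated with $f$. Then $$\mathfrak{R}(A\sigma B)\ \ge\ \int_0^1\Big(\big((\mathfrak{R}A)!_t(\mathfrak{R}B)\big)^{-1}-2r\big(\big((\mathfrak{R}A)!(\mathfrak{R}B)\big)^{-1}-\big(\mathfrak{R}(A!B)\big)^{-1}\big)\Big)^{-1}d\nu_f(t)\ \ge\ (\mathfrak{R}A)\,\sigma\,(\mathfrak{R}B),$$ where $r=r(t)=\min\{t,1-t\}$.
   Context: $\mathcal{M}_n$ is the algebra of complex $n\times n$ matrices; $\mathfrak{R}A=\frac{A+A^*}{2}$; $A$ is accretive if $\mathfrak{R}A>0$ (positive definite). Inequalities between Hermitian matrices are in the Loewner (positive semidefinite) order. The weighted harmonic mean is $A!_tB=((1-t)A^{-1}+tB^{-1})^{-1}$, and $!=\,!_{1/2}$. For a matrix monotone $f:(0,\infty)\to(0,\infty)$ with $f(1)=1$, the associated matrix mean of accretive (in particular, strictly positive) matrices is $A\sigma B=A^{1/2}f(A^{-1/2}BA^{-1/2})A^{1/2}$. Here $A^{1/2}$ is the principal square root, $A^{-1/2}BA^{-1/2}$ has no eigenvalue in $(-\infty,0]$, $f$ is extended analytically to $\mathbb{C}\setminus(-\infty,0]$, and $f(X)=\frac{1}{2\pi i}\int_\Gamma f(z)(zI-X)^{-1}dz$ for a matrix $X$ with no eigenvalue in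 $(-\infty,0]$, with $\Gamma$ a simple closed curve in the domain of analyticity surrounding the eigenvalues of $X$. The probability measure $\nu_f$ on $[0,1]$ is the one for which $f(X)=\int_0^1 I!_tX\,d\nu_f(t)$ for all such $X$ (in particular $f(x)=\int_0^1((1-t)+tx^{-1})^{-1}d\nu_f(t)$ for $x>0$); it is known that then $A\sigma B=\int_0^1 A!_tB\,d\nu_f(t)$ for accretive $A,B$. *)

theory Defs
  imports
    "HOL-Complex_Analysis.Winding_Numbers"
    "HOL-Probability.Probability_Measure"
    "Jordan_Normal_Form.Gauss_Jordan_Elimination"
    "Jordan_Normal_Form.Char_Poly"
    "Jordan_Normal_Form.Schur_Decomposition"
begin

section \<open>Hermitian matrices, the Loewner order, accretive matrices\<close>

definition hermitian_mat :: "complex mat \<Rightarrow> bool" where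
  "hermitian_mat A \<longleftrightarrow> square_mat A \<and> mat_adjoint A = A"

definition psd_mat :: "complex mat \<Rightarrow> bool" where
  "psd_mat A \<longleftrightarrow> hermitian_mat A \<and>
    (\<forall>v \<in> carrier_vec (dim_row A). 0 \<le> Re ((A *\<^sub>v v) \<bullet>c v))"

definition posdef_mat :: "complex mat \<Rightarrow> bool" where
  "posdef_mat A \<longleftrightarrow> hermitian_mat A \<and>
    (\<forall>v \<in> carrier_vec (dim_row A). v \<noteq> 0\<^sub>v (dim_row A) \<longrightarrow> 0 < Re ((A *\<^sub>v v) \<bullet>c v))"

definition loewner_le :: "complex mat \<Rightarrow> complex mat \<Rightarrow> bool" (infix \<open>\<le>\<^sub>L\<close> 50) where
  "A \<le>\<^sub>L B \<longleftrightarrow> hermitian_mat A \<and> hermitian_mat B \<and> dim_row A = dim_row B \<and> psd_mat (B - A)"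

definition Re_mat :: "complex mat \<Rightarrow> complex mat" where
  "Re_mat A = (1 / 2) \<cdot>\<^sub>m (A + mat_adjoint A)"

definition accretive :: "complex mat \<Rightarrow> bool" where
  "accretive A \<longleftrightarrow> square_mat A \<and> posdef_mat (Re_mat A)"

section \<open>Inverses, harmonic means, principal square roots, integrals\<close>

text \<open>Unspecified when the matrix is not invertible.\<close>

definition minv :: "complex mat \<Rightarrow> complex mat" where
  "minv A = the (mat_inverse A)"

definition wharm :: "real \<Rightarrow> complex mat \<Rightarrow> complex mat \<Rightarrow> complex mat" where
  "wharm t A B = minv (complex_of_real (1 - t) \<cdot>\<^sub>m minv A + complex_of_real t \<cdot>\<^sub>m minv B)"

abbreviation hmean :: "complex mat \<Rightarrow> complex mat \<Rightarrow> complex mat" where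
  "hmean \<equiv> wharm (1 / 2)"

definition principal_sqrt :: "complex mat \<Rightarrow> complex mat" where
  "principal_sqrt A = (THE S. S \<in> carrier_mat (dim_row A) (dim_row A) \<and> S * S = A \<and>
     (\<forall>k. eigenvalue S k \<longrightarrow> 0 < Re k))"

definition mat_integral :: "nat \<Rightarrow> real measure \<Rightarrow> (real \<Rightarrow> complex mat) \<Rightarrow> complex mat" where
  "mat_integral n \<nu> F = Matrix.mat n n (\<lambda>(i, j). \<integral>t. F t $$ (i, j) \<partial>\<nu>)"

section \<open>Matrix monotone functions\<close>

text \<open>The functional calculus for Hermitian matrices by unitary diagonalisation. Monotonicity
  needs it because a function is not known to be analytic before it is known to be monotone.\<close>

definition herm_fun :: "(real \<Rightarrow> real) \<Rightarrow> complex mat \<Rightarrow> complex mat" where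
  "herm_fun f A = (THE F. \<exists>U d.
     U \<in> carrier_mat (dim_row A) (dim_row A) \<and>
     mat_adjoint U * U = 1\<^sub>m (dim_row A) \<and>
     A = U * mat_diag (dim_row A) (\<lambda>i. complex_of_real (d i)) * mat_adjoint U \<and>
     F = U * mat_diag (dim_row A) (\<lambda>i. complex_of_real (f (d i))) * mat_adjoint U)"

text \<open>Monotonicity on positive definite matrices of every size; only the values of \<open>f\<close> on
  the positive half-line matter.\<close>

definition matrix_monotone :: "(real \<Rightarrow> real) \<Rightarrow> bool" where
  "matrix_monotone f \<longleftrightarrow>
    (\<forall>n. \<forall>A \<in> carrier_mat n n. \<forall>B \<in> carrier_mat n n.
       posdef_mat A \<longrightarrow> posdef_mat B \<longrightarrow> A \<le>\<^sub>L B \<longrightarrow> herm_fun f A \<le>\<^sub>L herm_fun f B)"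

section \<open>Holomorphic functional calculus on the slit plane\<close>

text \<open>On the slit plane the extension is unique by the identity theorem; on the cut its values
  are arbitrary and never used.\<close>

definition analytic_ext :: "(real \<Rightarrow> real) \<Rightarrow> complex \<Rightarrow> complex" where
  "analytic_ext f = (SOME g. g holomorphic_on (- \<real>\<^sub>\<le>\<^sub>0) \<and>
     (\<forall>x>0. g (complex_of_real x) = complex_of_real (f x)))"

definition slit_spectrum :: "complex mat \<Rightarrow> bool" where
  "slit_spectrum X \<longleftrightarrow> (\<forall>k. eigenvalue X k \<longrightarrow> k \<notin> \<real>\<^sub>\<le>\<^sub>0)"

definition surrounding_curve :: "complex mat \<Rightarrow> (real \<Rightarrow> complex) \<Rightarrow> bool" where
  "surrounding_curve X \<Gamma> \<longleftrightarrow>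
     valid_path \<Gamma> \<and> simple_path \<Gamma> \<and> pathfinish \<Gamma> = pathstart \<Gamma> \<and>
     path_image \<Gamma> \<subseteq> - \<real>\<^sub>\<le>\<^sub>0 \<and>
     (\<forall>k. eigenvalue X k \<longrightarrow> k \<in> inside (path_image \<Gamma>) \<and> winding_number \<Gamma> k = 1)"

text \<open>By Cauchy's theorem the integral does not depend on the chosen curve; it is taken entrywise.\<close>

definition hol_fun :: "(complex \<Rightarrow> complex) \<Rightarrow> complex mat \<Rightarrow> complex mat" where
  "hol_fun g X = (let n = dim_row X; \<Gamma> = (SOME \<Gamma>. surrounding_curve X \<Gamma>) in
     Matrix.mat n n (\<lambda>(i, j). 1 / (2 * of_real pi * \<i>) *
       contour_integral \<Gamma> (\<lambda>z. g z * (minv (z \<cdot>\<^sub>m 1\<^sub>m n - X) $$ (i, j)))))"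

definition matrix_mean ::
    "(real \<Rightarrow> real) \<Rightarrow> complex mat \<Rightarrow> complex mat \<Rightarrow> complex mat" where
  "matrix_mean f A B = (let S = principal_sqrt A; T = minv S in
     S * hol_fun (analytic_ext f) (T * B * T) * S)"

text \<open>\<open>\<nu>\<close> is the probability measure on the unit interval associated with \<open>f\<close>.\<close>

definition represents :: "real measure \<Rightarrow> (real \<Rightarrow> real) \<Rightarrow> bool" where
  "represents \<nu> f \<longleftrightarrow>
     prob_space \<nu> \<and> sets \<nu> = sets (restrict_space borel {0..1}) \<and>
     (\<forall>n. \<forall>X \<in> carrier_mat n n. slit_spectrum X \<longrightarrow>
        hol_fun (analytic_ext f) X = mat_integral n \<nu> (\<lambda>t. wharm t (1\<^sub>m n) X))"

end

theory Submission
  imports Defs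
begin

text \<open>
  For accretive \<open>Z\<close> put \<open>\<phi> Z = (\<Re> (Z\<^sup>-\<^sup>1))\<^sup>-\<^sup>1\<close>. Its quadratic form at \<open>v\<close> is the supremum over \<open>u\<close> of
  \<open>2 Re \<langle>Z v, u\<rangle> - Re \<langle>Z u, u\<rangle>\<close>, so \<open>\<phi>\<close> is convex. With \<open>X = A\<^sup>-\<^sup>1\<close>, \<open>Y = B\<^sup>-\<^sup>1\<close> and
  \<open>Z\<^sub>t = (1 - t) X + t Y\<close> one has \<open>\<phi> X = (\<Re> A)\<^sup>-\<^sup>1\<close>, \<open>\<phi> Y = (\<Re> B)\<^sup>-\<^sup>1\<close> and
  \<open>\<phi> Z\<^sub>t = (\<Re> (A !\<^sub>t B))\<^sup>-\<^sup>1\<close>. Convexity between an end point and the midpoint refines Jensen's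
  inequality by the term with \<open>2 min t (1 - t)\<close>; inverting and integrating over \<open>t\<close> gives both
  bounds, because the integral formula for \<open>f (A\<^sup>-\<^sup>1\<^sup>/\<^sup>2 B A\<^sup>-\<^sup>1\<^sup>/\<^sup>2)\<close> turns each mean into an integral of
  weighted harmonic means.
\<close>

section \<open>Adjoints, quadratic forms and inverses\<close>

lemma mat_adjoint_dim [simp]:
  "dim_row (mat_adjoint A) = dim_col A" "dim_col (mat_adjoint A) = dim_row A"
  unfolding mat_adjoint_def by auto

lemma mat_adjoint_carrier [simp]: "A \<in> carrier_mat m n \<Longrightarrow> mat_adjoint A \<in> carrier_mat n m"
  by auto

lemma mat_adjoint_mult_vec_carrier [simp]:
  "A \<in> carrier_mat m n \<Longrightarrow> mat_adjoint A *\<^sub>v v \<in> carrier_vec n"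
  by (rule carrier_vecI) simp

lemma mat_adjoint_index [simp]:
  fixes A :: "complex mat"
  assumes "i < dim_col A" "j < dim_row A"
  shows "mat_adjoint A $$ (i, j) = cnj (A $$ (j, i))"
  using assms unfolding mat_adjoint_def by (simp add: mat_of_rows_index)

lemma mat_adjoint_mult:
  fixes A B :: "complex mat"
  assumes "A \<in> carrier_mat m n" "B \<in> carrier_mat n k"
  shows "mat_adjoint (A * B) = mat_adjoint B * mat_adjoint A"
  using assms by (intro eq_matI) (auto simp: scalar_prod_def mult.commute intro!: sum.cong)

lemma mat_adjoint_one [simp]: "mat_adjoint (1\<^sub>m n) = (1\<^sub>m n :: complex mat)"
  by (intro eq_matI) auto

text \<open>The product is linear in its first argument and conjugate-linear in its second; this
  fixes the side on which adjoints appear below.\<close>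

lemma cscalar_prod_conv_sum:
  fixes v w :: "complex vec"
  assumes "w \<in> carrier_vec n"
  shows "v \<bullet>c w = (\<Sum>i<n. vec_index v i * cnj (vec_index w i))"
  using assms by (auto simp: scalar_prod_def atLeast0LessThan)

lemma cscalar_prod_cnj:
  fixes v w :: "complex vec"
  assumes "v \<in> carrier_vec n" "w \<in> carrier_vec n"
  shows "cnj (v \<bullet>c w) = w \<bullet>c v"
  using assms by (simp add: cscalar_prod_conv_sum mult.commute)

lemma Re_cscalar_prod_commute:
  fixes v w :: "complex vec"
  assumes "v \<in> carrier_vec n" "w \<in> carrier_vec n"
  shows "Re (v \<bullet>c w) = Re (w \<bullet>c v)"
  using cscalar_prod_cnj[OF assms] by (metis complex_cnj cnj.sel(1))

lemma mult_mat_vec_index_sum: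
  assumes "A \<in> carrier_mat m n" "v \<in> carrier_vec n" "i < m"
  shows "vec_index (A *\<^sub>v v) i = (\<Sum>j<n. A $$ (i, j) * vec_index v j)"
  using assms by (auto simp: scalar_prod_def atLeast0LessThan)

lemma cscalar_prod_adjoint:
  fixes A :: "complex mat"
  assumes A: "A \<in> carrier_mat m n" and v: "v \<in> carrier_vec m" and w: "w \<in> carrier_vec n"
  shows "(mat_adjoint A *\<^sub>v v) \<bullet>c w = v \<bullet>c (A *\<^sub>v w)"
proof -
  have Aw: "A *\<^sub>v w \<in> carrier_vec m" using A w by auto
  have "(mat_adjoint A *\<^sub>v v) \<bullet>c w = (\<Sum>i<n. \<Sum>j<m. cnj (A $$ (j, i)) * vec_index v j * cnj (vec_index w i))"
    using A v w
    by (auto simp: cscalar_prod_conv_sum[OF w] mult_mat_vec_index_sum[OF mat_adjoint_carrier[OF A] v]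
        sum_distrib_right simp del: index_mult_mat_vec intro!: sum.cong)
  also have "\<dots> = (\<Sum>j<m. \<Sum>i<n. cnj (A $$ (j, i)) * vec_index v j * cnj (vec_index w i))"
    by (rule sum.swap)
  also have "\<dots> = v \<bullet>c (A *\<^sub>v w)"
    by (auto simp: cscalar_prod_conv_sum[OF Aw] mult_mat_vec_index_sum[OF A w] sum_distrib_left
        mult_ac simp del: index_mult_mat_vec intro!: sum.cong)
  finally show ?thesis .
qed

lemma smult_mat_mult_vec:
  assumes "A \<in> carrier_mat m n" "v \<in> carrier_vec n"
  shows "(c \<cdot>\<^sub>m A) *\<^sub>v v = c \<cdot>\<^sub>v (A *\<^sub>v v)"
  using assms by (intro eq_vecI) (auto simp: scalar_prod_def sum_distrib_left mult.assoc)

section \<open>Real quadratic forms, Hermitian parts and the Loewner order\<close>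

definition qform :: "complex mat \<Rightarrow> complex vec \<Rightarrow> real" where
  "qform A v = Re ((A *\<^sub>v v) \<bullet>c v)"

text \<open>Each entry of \<open>A\<close> is paired with a weight depending only on
  \<open>v\<close>, so linearity in \<open>A\<close>, and later the exchange with an entrywise
  integral, follow termwise.\<close>

lemma qform_conv_sum:
  assumes "A \<in> carrier_mat n n" "v \<in> carrier_vec n"
  shows "qform A v = Re (\<Sum>i<n. \<Sum>j<n. A $$ (i, j) * (vec_index v j * cnj (vec_index v i)))"
  using assms unfolding qform_def
  by (intro arg_cong[of _ _ Re])
    (simp add: cscalar_prod_conv_sum mult_mat_vec_index_sum sum_distrib_right mult.assoc
      del: index_mult_mat_vec)

lemma qform_add:
  assumes "A \<in> carrier_mat n n" "B \<in> carrier_mat n n" "v \<in> carrier_vec n"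
  shows "qform (A + B) v = qform A v + qform B v"
  using assms by (simp add: qform_conv_sum[of _ n] sum.distrib distrib_right)

lemma qform_diff:
  assumes "A \<in> carrier_mat n n" "B \<in> carrier_mat n n" "v \<in> carrier_vec n"
  shows "qform (A - B) v = qform A v - qform B v"
proof -
  have "A - B \<in> carrier_mat n n" using assms by auto
  then show ?thesis
    using assms by (simp add: qform_conv_sum[of _ n] sum_subtractf left_diff_distrib)
qed

lemma qform_smult:
  assumes "A \<in> carrier_mat n n" "v \<in> carrier_vec n"
  shows "qform (complex_of_real c \<cdot>\<^sub>m A) v = c * qform A v"
  using assms by (simp add: qform_conv_sum[of _ n] sum_distrib_left mult.assoc)

lemma qform_adjoint:
  assumes "A \<in> carrier_mat n n" "v \<in> carrier_vec n"
  shows "qform (mat_adjoint A) v = qform A v"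
  unfolding qform_def cscalar_prod_adjoint[OF assms(1,2,2)]
  using assms by (intro Re_cscalar_prod_commute[of _ n]) auto

lemma Re_mat_carrier [simp]: "A \<in> carrier_mat n n \<Longrightarrow> Re_mat A \<in> carrier_mat n n"
  by (auto simp: Re_mat_def)

lemma Re_mat_index:
  assumes "A \<in> carrier_mat n n" "i < n" "j < n"
  shows "Re_mat A $$ (i, j) = (A $$ (i, j) + cnj (A $$ (j, i))) / 2"
  using assms by (simp add: Re_mat_def)

text \<open>\<open>A\<close> and its adjoint have the same real form, hence so does their average.
  Statements about the Hermitian part can thus be proved on \<open>A\<close> itself.\<close>

lemma qform_Re_mat:
  assumes "A \<in> carrier_mat n n" "v \<in> carrier_vec n"
  shows "qform (Re_mat A) v = qform A v"
proof -
  have "Re_mat A = complex_of_real (1/2) \<cdot>\<^sub>m (A + mat_adjoint A)"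
    by (simp add: Re_mat_def)
  then show ?thesis
    using qform_smult[of "A + mat_adjoint A" n v "1/2"] assms
    by (simp add: qform_add[of _ n] qform_adjoint[of _ n])
qed

lemma hermitian_mat_iff:
  assumes "A \<in> carrier_mat n n"
  shows "hermitian_mat A \<longleftrightarrow> (\<forall>i<n. \<forall>j<n. cnj (A $$ (j, i)) = A $$ (i, j))"
proof
  assume "hermitian_mat A"
  then show "\<forall>i<n. \<forall>j<n. cnj (A $$ (j, i)) = A $$ (i, j)"
    using assms unfolding hermitian_mat_def
    by (metis carrier_matD mat_adjoint_index)
next
  assume "\<forall>i<n. \<forall>j<n. cnj (A $$ (j, i)) = A $$ (i, j)"
  then show "hermitian_mat A"
    using assms unfolding hermitian_mat_def by (auto intro!: eq_matI)
qed

lemma hermitian_Re_mat: "A \<in> carrier_mat n n \<Longrightarrow> hermitian_mat (Re_mat A)"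
  by (simp add: hermitian_mat_iff[of _ n] Re_mat_index add.commute)

lemma hermitian_add:
  assumes "A \<in> carrier_mat n n" "B \<in> carrier_mat n n" "hermitian_mat A" "hermitian_mat B"
  shows "hermitian_mat (A + B)"
proof -
  have "A + B \<in> carrier_mat n n" using assms by auto
  with assms show ?thesis
    by (simp add: hermitian_mat_iff[of _ n])
qed

lemma hermitian_smult:
  assumes "A \<in> carrier_mat n n" "hermitian_mat A"
  shows "hermitian_mat (complex_of_real c \<cdot>\<^sub>m A)"
proof -
  have "complex_of_real c \<cdot>\<^sub>m A \<in> carrier_mat n n" using assms by auto
  with assms show ?thesis
    by (simp add: hermitian_mat_iff[of _ n])
qed

lemma hermitian_diff:
  assumes "A \<in> carrier_mat n n" "B \<in> carrier_mat n n" "hermitian_mat A" "hermitian_mat B"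
  shows "hermitian_mat (A - B)"
proof -
  have "A - B \<in> carrier_mat n n" using assms by auto
  with assms show ?thesis
    by (simp add: hermitian_mat_iff[of _ n])
qed

lemma loewner_le_iff:
  assumes "A \<in> carrier_mat n n" "B \<in> carrier_mat n n" "hermitian_mat A" "hermitian_mat B"
  shows "A \<le>\<^sub>L B \<longleftrightarrow> (\<forall>v\<in>carrier_vec n. qform A v \<le> qform B v)"
proof -
  have "dim_row (B - A) = n" using assms by auto
  then show ?thesis
    using assms hermitian_diff[OF assms(2,1,4,3)]
    unfolding loewner_le_def psd_mat_def qform_def[symmetric]
    by (auto simp: qform_diff)
qed

text \<open>By \<open>qform_Re_mat\<close> the condition on the Hermitian part becomes one on
  \<open>A\<close>. For Hermitian \<open>A\<close> it is positive definiteness, so one predicate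
  covers both kinds of matrices.\<close>

lemma accretive_iff:
  assumes "A \<in> carrier_mat n n"
  shows "accretive A \<longleftrightarrow> (\<forall>v\<in>carrier_vec n. v \<noteq> 0\<^sub>v n \<longrightarrow> 0 < qform A v)"
proof -
  have "dim_row (Re_mat A) = n" using assms by (auto simp: Re_mat_def)
  then show ?thesis
    using assms hermitian_Re_mat[OF assms]
    unfolding accretive_def posdef_mat_def qform_def[symmetric]
    by (auto simp: qform_Re_mat)
qed

lemma accretive_qform_nonneg:
  assumes "A \<in> carrier_mat n n" "accretive A" "v \<in> carrier_vec n"
  shows "0 \<le> qform A v"
proof (cases "v = 0\<^sub>v n")
  case True
  have "0\<^sub>v n \<in> carrier_vec n" by simp
  from qform_conv_sum[OF assms(1) this] show ?thesis using True by simp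
next
  case False
  then show ?thesis using assms accretive_iff by force
qed

lemma accretive_Re_mat: "A \<in> carrier_mat n n \<Longrightarrow> accretive A \<Longrightarrow> accretive (Re_mat A)"
  by (simp add: accretive_iff[of _ n] qform_Re_mat)

text \<open>A nonzero kernel vector would make the form vanish.\<close>

lemma accretive_det_nonzero:
  assumes "A \<in> carrier_mat n n" "accretive A"
  shows "Determinant.det A \<noteq> 0"
proof
  assume "Determinant.det A = 0"
  then obtain v where v: "v \<in> carrier_vec n" "v \<noteq> 0\<^sub>v n" "A *\<^sub>v v = 0\<^sub>v n"
    using det_0_iff_vec_prod_zero_field[OF assms(1)] by auto
  have "qform A v = 0" unfolding qform_def v(3) using v(1) by simp
  then show False using v assms accretive_iff by force
qed

section \<open>Matrix inverses and their accretivity\<close>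

lemma minv_inverse:
  assumes "A \<in> carrier_mat n n" "Determinant.det A \<noteq> 0"
  shows "minv A \<in> carrier_mat n n" "A * minv A = 1\<^sub>m n" "minv A * A = 1\<^sub>m n"
proof -
  have "A \<in> Units (ring_mat TYPE(complex) n ())"
    by (rule det_non_zero_imp_unit[OF assms])
  then obtain B where "mat_inverse A = Some B"
    using mat_inverse(1)[OF assms(1), of "()"] by (cases "mat_inverse A") auto
  then show "minv A \<in> carrier_mat n n" "A * minv A = 1\<^sub>m n" "minv A * A = 1\<^sub>m n"
    using mat_inverse(2)[OF assms(1)] unfolding minv_def by auto
qed

lemma det_nonzero_of_right_inverse:
  fixes A :: "complex mat"
  assumes "A \<in> carrier_mat n n" "B \<in> carrier_mat n n" "A * B = 1\<^sub>m n"
  shows "Determinant.det A \<noteq> 0"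
  using det_mult[OF assms(1,2)] assms(3) by auto

text \<open>A right inverse of a square matrix is the inverse; explicit formulas for
  \<open>minv\<close> are verified this way.\<close>

lemma minv_unique:
  assumes A: "A \<in> carrier_mat n n" and B: "B \<in> carrier_mat n n" and AB: "A * B = 1\<^sub>m n"
  shows "minv A = B"
proof -
  note i = minv_inverse[OF A det_nonzero_of_right_inverse[OF assms]]
  have "minv A = minv A * (A * B)" unfolding AB using i(1) by simp
  also have "\<dots> = minv A * A * B" using i(1) A B by (intro assoc_mult_mat[symmetric])
  also have "\<dots> = B" unfolding i(3) using B by simp
  finally show ?thesis .
qed

lemma minv_one [simp]: "minv (1\<^sub>m n) = 1\<^sub>m n"
  by (rule minv_unique[of _ n]) auto

lemma minv_minv:
  assumes "A \<in> carrier_mat n n" "Determinant.det A \<noteq> 0"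
  shows "minv (minv A) = A"
  using minv_inverse[OF assms] assms by (intro minv_unique) auto

lemma det_minv_nonzero:
  assumes "A \<in> carrier_mat n n" "Determinant.det A \<noteq> 0"
  shows "Determinant.det (minv A) \<noteq> 0"
  using minv_inverse[OF assms] assms det_nonzero_of_right_inverse by blast

lemma minv_adjoint:
  assumes A: "A \<in> carrier_mat n n" and d: "Determinant.det A \<noteq> 0"
  shows "mat_adjoint A * mat_adjoint (minv A) = 1\<^sub>m n"
  using minv_inverse[OF A d] A mat_adjoint_mult[of "minv A" n n A n] by simp

lemma hermitian_minv:
  assumes A: "A \<in> carrier_mat n n" and d: "Determinant.det A \<noteq> 0" and h: "hermitian_mat A"
  shows "hermitian_mat (minv A)"
proof -
  note i = minv_inverse[OF A d]
  have "A * mat_adjoint (minv A) = 1\<^sub>m n"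
    using minv_adjoint[OF A d] h unfolding hermitian_mat_def by simp
  then have "minv A = mat_adjoint (minv A)"
    using i A by (intro minv_unique) auto
  then show ?thesis using i unfolding hermitian_mat_def by auto
qed

lemma minv_mult_vec:
  assumes "A \<in> carrier_mat n n" "Determinant.det A \<noteq> 0" "v \<in> carrier_vec n"
  shows "minv A *\<^sub>v v \<in> carrier_vec n" "A *\<^sub>v (minv A *\<^sub>v v) = v"
  using assms minv_inverse[OF assms(1,2)]
  by (auto simp flip: assoc_mult_mat_vec[of _ n n _ n])

text \<open>Writing \<open>v\<close> as \<open>A w\<close>, the form of the inverse at
  \<open>v\<close> equals the form of \<open>A\<close> at \<open>w\<close>, because the real part
  ignores the order of the two arguments.\<close>

lemma accretive_minv:
  assumes A: "A \<in> carrier_mat n n" and a: "accretive A"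
  shows "accretive (minv A)"
proof -
  note d = accretive_det_nonzero[OF A a]
  note i = minv_inverse[OF A d]
  have "0 < qform (minv A) v" if v: "v \<in> carrier_vec n" "v \<noteq> 0\<^sub>v n" for v
  proof -
    define w where "w = minv A *\<^sub>v v"
    have w: "w \<in> carrier_vec n" "A *\<^sub>v w = v"
      unfolding w_def using minv_mult_vec[OF A d v(1)] by auto
    have "w \<noteq> 0\<^sub>v n" using w(2) v(2) A by auto
    then have "0 < qform A w" using a accretive_iff[OF A] w by auto
    also have "qform A w = qform (minv A) v"
      unfolding qform_def w(2) w_def[symmetric] using w v by (intro Re_cscalar_prod_commute) auto
    finally show ?thesis .
  qed
  then show ?thesis using accretive_iff[OF i(1)] by blast
qed

lemma accretive_minv_carrier:
  assumes "A \<in> carrier_mat n n" "accretive A"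
  shows "minv A \<in> carrier_mat n n"
  using minv_inverse(1)[OF assms(1) accretive_det_nonzero[OF assms]] .

lemma accretive_convex:
  assumes X: "X \<in> carrier_mat n n" "accretive X" and Y: "Y \<in> carrier_mat n n" "accretive Y"
    and s: "0 \<le> s" "s \<le> 1"
  shows "accretive (complex_of_real (1 - s) \<cdot>\<^sub>m X + complex_of_real s \<cdot>\<^sub>m Y)"
proof -
  have c: "complex_of_real (1 - s) \<cdot>\<^sub>m X + complex_of_real s \<cdot>\<^sub>m Y \<in> carrier_mat n n"
    using X Y by auto
  have "0 < qform (complex_of_real (1 - s) \<cdot>\<^sub>m X + complex_of_real s \<cdot>\<^sub>m Y) v"
    if v: "v \<in> carrier_vec n" "v \<noteq> 0\<^sub>v n" for v
  proof -
    have p: "0 < qform X v" "0 < qform Y v"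
      using v X Y by (auto simp: accretive_iff)
    have "0 < (1 - s) * qform X v + s * qform Y v"
    \<comment> \<open>A weight may be zero: strictness comes from \<open>Y\<close> when
      \<open>s\<close> is positive and from \<open>X\<close> when it is zero.\<close>
    proof (cases "s = 0")
      case False
      then have "0 < s * qform Y v" "0 \<le> (1 - s) * qform X v" using s p by auto
      then show ?thesis by linarith
    qed (use p in auto)
    then show ?thesis
      using X Y v by (simp add: qform_add[of _ n] qform_smult[of _ n] del: of_real_diff)
  qed
  then show ?thesis using accretive_iff[OF c] by blast
qed

section \<open>Convexity of the inverse of the real part of the inverse\<close>

text \<open>Completing the square: with \<open>y\<close> the solution of \<open>P y = x\<close>,
  expand \<open>0 \<le> qform P (y - w)\<close>. Hermitian symmetry makes the two cross terms
  equal.\<close>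

lemma qform_minv_ge:
  assumes P: "P \<in> carrier_mat n n" "hermitian_mat P" "accretive P"
    and x: "x \<in> carrier_vec n" and w: "w \<in> carrier_vec n"
  shows "2 * Re (x \<bullet>c w) - qform P w \<le> qform (minv P) x"
proof -
  note d = accretive_det_nonzero[OF P(1,3)]
  note i = minv_inverse[OF P(1) d]
  define y where "y = minv P *\<^sub>v x"
  have y: "y \<in> carrier_vec n" "P *\<^sub>v y = x"
    unfolding y_def using minv_mult_vec[OF P(1) d x] by auto
  have "0 \<le> qform P (y - w)" using accretive_qform_nonneg P y w by auto
  also have "qform P (y - w) = Re (x \<bullet>c y) - Re (x \<bullet>c w) - Re ((P *\<^sub>v w) \<bullet>c y) + qform P w"
  proof -
    have Pw: "P *\<^sub>v w \<in> carrier_vec n" using P w by auto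
    have "P *\<^sub>v (y - w) = x - P *\<^sub>v w"
      using y P w by (metis mult_minus_distrib_mat_vec)
    moreover have "conjugate (y - w) = conjugate y - conjugate w"
      using y w by (intro eq_vecI) auto
    ultimately show ?thesis
      using x y(1) w Pw unfolding qform_def
      by (simp add: minus_scalar_prod_distrib[of _ n] scalar_prod_minus_distrib[of _ n])
  qed
  also have "(P *\<^sub>v w) \<bullet>c y = w \<bullet>c x"
    using cscalar_prod_adjoint[OF P(1) w y(1)] P(2) y(2) unfolding hermitian_mat_def by simp
  also have "Re (w \<bullet>c x) = Re (x \<bullet>c w)" using x w by (rule Re_cscalar_prod_commute[symmetric])
  also have "Re (x \<bullet>c y) = qform (minv P) x"
    unfolding qform_def y_def[symmetric] using x y(1) by (rule Re_cscalar_prod_commute)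
  finally show ?thesis by linarith
qed

text \<open>The witness is the solution of \<open>P w = x\<close>. For Hermitian \<open>P\<close>
  the bound of \<open>qform_minv_ge\<close> is therefore attained, and the form of the inverse is a
  maximum of functions affine in \<open>P\<close>.\<close>

lemma qform_minv_eq:
  assumes P: "P \<in> carrier_mat n n" "accretive P"
    and x: "x \<in> carrier_vec n"
  shows "\<exists>w\<in>carrier_vec n. qform (minv P) x = 2 * Re (x \<bullet>c w) - qform P w"
proof -
  note d = accretive_det_nonzero[OF P]
  define y where "y = minv P *\<^sub>v x"
  have y: "y \<in> carrier_vec n" "P *\<^sub>v y = x"
    unfolding y_def using minv_mult_vec[OF P(1) d x] by auto
  have "qform (minv P) x = Re (x \<bullet>c y)"
    unfolding qform_def y_def[symmetric] using y(1) x by (rule Re_cscalar_prod_commute)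
  moreover have "qform P y = Re (x \<bullet>c y)" by (simp add: qform_def y)
  ultimately show ?thesis using y by (intro bexI[of _ y]) auto
qed

text \<open>A maximiser for \<open>R\<close> is a competitor for \<open>P\<close>, where the
  subtracted form is smaller.\<close>

lemma qform_minv_antimono:
  assumes P: "P \<in> carrier_mat n n" "hermitian_mat P" "accretive P"
    and R: "R \<in> carrier_mat n n" "accretive R"
    and le: "\<And>v. v \<in> carrier_vec n \<Longrightarrow> qform P v \<le> qform R v"
    and x: "x \<in> carrier_vec n"
  shows "qform (minv R) x \<le> qform (minv P) x"
proof -
  obtain w where "w \<in> carrier_vec n" "qform (minv R) x = 2 * Re (x \<bullet>c w) - qform R w"
    using qform_minv_eq[OF R x] by blast
  with qform_minv_ge[OF P x, of w] le[of w] show ?thesis by linarith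
qed

text \<open>This is the map \<phi>. With \<open>H\<close> the Hermitian part of \<open>Z\<close> it
  equals \<open>Z* H^-1 Z\<close>, a matrix analogue of the jointly convex function
  \<open>|z|^2 / h\<close>.\<close>

definition inv_Re_inv :: "complex mat \<Rightarrow> complex mat" where
  "inv_Re_inv Z = minv (Re_mat (minv Z))"

lemma Re_mat_minv_facts:
  assumes "Z \<in> carrier_mat n n" "accretive Z"
  shows "Re_mat (minv Z) \<in> carrier_mat n n" "hermitian_mat (Re_mat (minv Z))"
    "accretive (Re_mat (minv Z))"
  using minv_inverse[OF assms(1) accretive_det_nonzero[OF assms]] accretive_minv[OF assms]
  by (auto intro: hermitian_Re_mat accretive_Re_mat)

lemma inv_Re_inv_facts:
  assumes "Z \<in> carrier_mat n n" "accretive Z"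
  shows "inv_Re_inv Z \<in> carrier_mat n n" "hermitian_mat (inv_Re_inv Z)" "accretive (inv_Re_inv Z)"
proof -
  note f = Re_mat_minv_facts[OF assms]
  note d = accretive_det_nonzero[OF f(1,3)]
  show "inv_Re_inv Z \<in> carrier_mat n n" "hermitian_mat (inv_Re_inv Z)" "accretive (inv_Re_inv Z)"
    unfolding inv_Re_inv_def
    by (fact minv_inverse(1)[OF f(1) d] hermitian_minv[OF f(1) d f(2)] accretive_minv[OF f(1,3)])+
qed

text \<open>Substituting the image of \<open>u\<close> under the adjoint of \<open>Z\<close> removes
  the inverse: the variational formula for \<open>minv (Re_mat (minv Z))\<close> acquires terms that
  are real-linear in \<open>Z\<close>.\<close>

lemma qform_Re_mat_minv_adjoint:
  assumes Z: "Z \<in> carrier_mat n n" "accretive Z" and u: "u \<in> carrier_vec n"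
  shows "qform (Re_mat (minv Z)) (mat_adjoint Z *\<^sub>v u) = qform Z u"
proof -
  note d = accretive_det_nonzero[OF Z]
  note i = minv_inverse[OF Z(1) d]
  let ?w = "mat_adjoint Z *\<^sub>v u"
  have w: "?w \<in> carrier_vec n" using Z u by auto
  have "qform (Re_mat (minv Z)) ?w = qform (minv Z) ?w"
    using qform_Re_mat[OF i(1) w] .
  also have "\<dots> = Re (?w \<bullet>c (minv Z *\<^sub>v ?w))"
    unfolding qform_def using i w by (intro Re_cscalar_prod_commute[of _ n]) auto
  also have "?w \<bullet>c (minv Z *\<^sub>v ?w) = u \<bullet>c (Z *\<^sub>v (minv Z *\<^sub>v ?w))"
    using cscalar_prod_adjoint[OF Z(1) u] i w by auto
  also have "Z *\<^sub>v (minv Z *\<^sub>v ?w) = ?w" using minv_mult_vec[OF Z(1) d w] by simp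
  also have "Re (u \<bullet>c ?w) = qform (mat_adjoint Z) u"
    unfolding qform_def using u w by (rule Re_cscalar_prod_commute)
  finally show ?thesis using qform_adjoint[OF Z(1) u] by simp
qed

lemma Re_cscalar_prod_adjoint:
  assumes "Z \<in> carrier_mat n n" "v \<in> carrier_vec n" "u \<in> carrier_vec n"
  shows "Re (v \<bullet>c (mat_adjoint Z *\<^sub>v u)) = Re ((Z *\<^sub>v v) \<bullet>c u)"
proof -
  have "Re (v \<bullet>c (mat_adjoint Z *\<^sub>v u)) = Re ((mat_adjoint Z *\<^sub>v u) \<bullet>c v)"
    using assms by (intro Re_cscalar_prod_commute[of _ n]) auto
  also have "\<dots> = Re (u \<bullet>c (Z *\<^sub>v v))" using cscalar_prod_adjoint[OF assms(1,3,2)] by simp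
  also have "\<dots> = Re ((Z *\<^sub>v v) \<bullet>c u)"
    using assms by (intro Re_cscalar_prod_commute[of _ n]) auto
  finally show ?thesis .
qed

text \<open>This is \<open>qform_minv_ge\<close> for the Hermitian part of \<open>minv Z\<close>,
  with the image of \<open>u\<close> under the adjoint of \<open>Z\<close> as test vector.\<close>

lemma qform_inv_Re_inv_ge:
  assumes Z: "Z \<in> carrier_mat n n" "accretive Z"
    and v: "v \<in> carrier_vec n" and u: "u \<in> carrier_vec n"
  shows "2 * Re ((Z *\<^sub>v v) \<bullet>c u) - qform Z u \<le> qform (inv_Re_inv Z) v"
proof -
  have "mat_adjoint Z *\<^sub>v u \<in> carrier_vec n" using Z u by auto
  from qform_minv_ge[OF Re_mat_minv_facts[OF Z] v this] show ?thesis
    by (simp add: inv_Re_inv_def qform_Re_mat_minv_adjoint[OF Z u] Re_cscalar_prod_adjoint[OF Z(1) v u])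
qed

lemma qform_inv_Re_inv_eq:
  assumes Z: "Z \<in> carrier_mat n n" "accretive Z" and v: "v \<in> carrier_vec n"
  shows "\<exists>u\<in>carrier_vec n. qform (inv_Re_inv Z) v = 2 * Re ((Z *\<^sub>v v) \<bullet>c u) - qform Z u"
proof -
  note d = accretive_det_nonzero[OF Z]
  note i = minv_inverse[OF Z(1) d]
  obtain w where w: "w \<in> carrier_vec n"
      "qform (inv_Re_inv Z) v = 2 * Re (v \<bullet>c w) - qform (Re_mat (minv Z)) w"
    using qform_minv_eq[OF Re_mat_minv_facts(1,3)[OF Z] v] unfolding inv_Re_inv_def by blast
  \<comment> \<open>The adjoint of \<open>Z\<close> is invertible, so the optimal \<open>w\<close>
    is the image of exactly this \<open>u\<close> and the substitution loses no candidates.\<close>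
  define u where "u = mat_adjoint (minv Z) *\<^sub>v w"
  have u: "u \<in> carrier_vec n" unfolding u_def using i w by auto
  have "mat_adjoint Z *\<^sub>v u = (mat_adjoint Z * mat_adjoint (minv Z)) *\<^sub>v w"
    unfolding u_def using i Z w by (intro assoc_mult_mat_vec[symmetric]) auto
  then have wu: "w = mat_adjoint Z *\<^sub>v u"
    using minv_adjoint[OF Z(1) d] w by simp
  show ?thesis
    using w(2) u unfolding wu
    by (auto simp: qform_Re_mat_minv_adjoint[OF Z u] Re_cscalar_prod_adjoint[OF Z(1) v u])
qed

text \<open>The quadratic form of \<open>inv_Re_inv Z\<close> is a supremum of real-linear functions of \<open>Z\<close>.\<close>

lemma qform_inv_Re_inv_convex:
  assumes X: "X \<in> carrier_mat n n" "accretive X" and Y: "Y \<in> carrier_mat n n" "accretive Y"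
    and s: "0 \<le> s" "s \<le> 1" and v: "v \<in> carrier_vec n"
  shows "qform (inv_Re_inv (complex_of_real (1 - s) \<cdot>\<^sub>m X + complex_of_real s \<cdot>\<^sub>m Y)) v
    \<le> (1 - s) * qform (inv_Re_inv X) v + s * qform (inv_Re_inv Y) v"
proof -
  let ?Z = "complex_of_real (1 - s) \<cdot>\<^sub>m X + complex_of_real s \<cdot>\<^sub>m Y"
  have Z: "?Z \<in> carrier_mat n n" using X Y by auto
  \<comment> \<open>\<open>u\<close> is optimal for the convex combination but only a candidate for
    \<open>X\<close> and for \<open>Y\<close>; this is where the inequality arises.\<close>
  obtain u where u: "u \<in> carrier_vec n"
      "qform (inv_Re_inv ?Z) v = 2 * Re ((?Z *\<^sub>v v) \<bullet>c u) - qform ?Z u"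
    using qform_inv_Re_inv_eq[OF Z accretive_convex[OF X Y s] v] by blast
  have "?Z *\<^sub>v v = complex_of_real (1 - s) \<cdot>\<^sub>v (X *\<^sub>v v) + complex_of_real s \<cdot>\<^sub>v (Y *\<^sub>v v)"
    using X Y v by (simp add: add_mult_distrib_mat_vec[of _ n n] smult_mat_mult_vec[of _ n n])
  then have "(?Z *\<^sub>v v) \<bullet>c u
      = complex_of_real (1 - s) * ((X *\<^sub>v v) \<bullet>c u) + complex_of_real s * ((Y *\<^sub>v v) \<bullet>c u)"
    using X Y v u(1) by (simp add: add_scalar_prod_distrib[of _ n])
  then have "Re ((?Z *\<^sub>v v) \<bullet>c u) = (1 - s) * Re ((X *\<^sub>v v) \<bullet>c u) + s * Re ((Y *\<^sub>v v) \<bullet>c u)"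
    by simp
  moreover have "qform ?Z u = (1 - s) * qform X u + s * qform Y u"
    using X Y u(1) by (simp add: qform_add[of _ n] qform_smult[of _ n] del: of_real_diff)
  ultimately have "qform (inv_Re_inv ?Z) v = (1 - s) * (2 * Re ((X *\<^sub>v v) \<bullet>c u) - qform X u)
      + s * (2 * Re ((Y *\<^sub>v v) \<bullet>c u) - qform Y u)"
    using u(2) by (simp add: algebra_simps)
  also have "\<dots> \<le> (1 - s) * qform (inv_Re_inv X) v + s * qform (inv_Re_inv Y) v"
    using qform_inv_Re_inv_ge[OF X v u(1)] qform_inv_Re_inv_ge[OF Y v u(1)] s
    by (intro add_mono mult_left_mono) auto
  finally show ?thesis .
qed

section \<open>Principal square roots\<close>

lemma eigenvalue_upper_triangular:
  assumes "T \<in> carrier_mat n n" "upper_triangular T"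
  shows "eigenvalue T k \<longleftrightarrow> k \<in> set (diag_mat (T :: complex mat))"
  unfolding eigenvalue_root_char_poly[OF assms(1)] char_poly_upper_triangular[OF assms]
  by (auto simp: poly_prod_list o_def prod_list_zero_iff)

lemma eigenvalue_similar:
  assumes "A \<in> carrier_mat n n" "B \<in> carrier_mat n n" "similar_mat A B"
  shows "eigenvalue A k \<longleftrightarrow> eigenvalue B (k :: complex)"
  using assms by (simp add: eigenvalue_root_char_poly char_poly_similar)

text \<open>Of Schur's theorem only similarity to a triangular matrix is retained; the last clause
  carries spectral assumptions on \<open>A\<close> over to the diagonal.\<close>

lemma schur_triangularization:
  fixes A :: "complex mat"
  assumes A: "A \<in> carrier_mat n n"
  obtains P T Q where "P \<in> carrier_mat n n" "T \<in> carrier_mat n n" "Q \<in> carrier_mat n n"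
    "P * Q = 1\<^sub>m n" "Q * P = 1\<^sub>m n" "A = P * T * Q" "upper_triangular T"
    "\<And>i. i < n \<Longrightarrow> eigenvalue A (T $$ (i, i))"
proof -
  obtain es where "char_poly A = (\<Prod>a\<leftarrow>es. [:- a, 1:])"
    using char_poly_factorized[OF A] by blast
  then obtain T where T: "T \<in> carrier_mat n n" "upper_triangular T" "similar_mat A T"
    using schur_decomposition_exists[OF A] by blast
  then obtain P Q where "similar_mat_wit A T P Q" unfolding similar_mat_def by blast
  note w = similar_mat_witD2[OF A this]
  have "eigenvalue A (T $$ (i, i))" if "i < n" for i
    unfolding eigenvalue_similar[OF A T(1,3)] eigenvalue_upper_triangular[OF T(1,2)]
    using that T(1) by (auto simp: diag_mat_def)
  with w T show ?thesis using that by blast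
qed

text \<open>The real part is nonnegative; were it zero, \<open>csqrt z\<close> would be purely
  imaginary and its square a nonpositive real.\<close>

lemma Re_csqrt_pos:
  assumes "z \<notin> \<real>\<^sub>\<le>\<^sub>0"
  shows "0 < Re (csqrt z)"
proof (rule ccontr)
  assume "\<not> 0 < Re (csqrt z)"
  then have "Re (csqrt z) = 0" using Re_csqrt[of z] by linarith
  then have "csqrt z = \<i> * complex_of_real (Im (csqrt z))" by (simp add: complex_eq_iff)
  then have "z = (\<i> * complex_of_real (Im (csqrt z)))\<^sup>2" by (metis power2_csqrt)
  also have "\<dots> = complex_of_real (- (Im (csqrt z))\<^sup>2)" by (simp add: power_mult_distrib)
  finally show False
    using assms by (metis neg_le_0_iff_le nonpos_Reals_of_real_iff zero_le_power2)
qed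

text \<open>Solves \<open>(S * S) $$ (i, j) = T $$ (i, j)\<close> for \<open>S $$ (i, j)\<close>,
  one superdiagonal after another: the sum involves only entries closer to the diagonal.\<close>

function tri_sqrt_entry :: "complex mat \<Rightarrow> nat \<Rightarrow> nat \<Rightarrow> complex" where
  "tri_sqrt_entry T i j =
    (if i = j then csqrt (T $$ (i, i))
     else if i < j then
       (T $$ (i, j) - (\<Sum>k\<in>{i<..<j}. tri_sqrt_entry T i k * tri_sqrt_entry T k j))
         / (csqrt (T $$ (i, i)) + csqrt (T $$ (j, j)))
     else 0)"
  by pat_completeness auto
termination by (relation "Wellfounded.measure (\<lambda>(T, i, j). j - i)") auto

declare tri_sqrt_entry.simps [simp del]

lemma upper_triangular_sqrt:
  fixes T :: "complex mat"
  assumes T: "T \<in> carrier_mat n n" "upper_triangular T"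
    and slit: "\<And>i. i < n \<Longrightarrow> T $$ (i, i) \<notin> \<real>\<^sub>\<le>\<^sub>0"
  obtains S where "S \<in> carrier_mat n n" "upper_triangular S" "S * S = T"
    "\<And>i. i < n \<Longrightarrow> S $$ (i, i) = csqrt (T $$ (i, i))"
proof -
  let ?s = "tri_sqrt_entry T"
  define S where "S = Matrix.mat n n (\<lambda>(i, j). ?s i j)"
  have S: "S \<in> carrier_mat n n" unfolding S_def by simp
  have diag: "?s i i = csqrt (T $$ (i, i))" for i by (subst tri_sqrt_entry.simps) simp
  have lower: "?s i j = 0" if "j < i" for i j
    using that by (subst tri_sqrt_entry.simps) simp
  have ut: "upper_triangular S"
    by (rule upper_triangularI) (auto simp: S_def lower)
  have "S * S = T"
  proof (rule eq_matI)
    fix i j assume "i < dim_row T" "j < dim_col T"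
    then have ij: "i < n" "j < n" using T by auto
    have "(S * S) $$ (i, j) = (\<Sum>k<n. ?s i k * ?s k j)"
      using ij by (simp add: S_def scalar_prod_def atLeast0LessThan)
    \<comment> \<open>Factors below the diagonal vanish, leaving the indices from \<open>i\<close>
      to \<open>j\<close>; this range is empty when \<open>i > j\<close>.\<close>
    also have "\<dots> = (\<Sum>k\<in>{i..j}. ?s i k * ?s k j)"
      using ij by (intro sum.mono_neutral_right) (auto simp: lower not_le)
    also have "\<dots> = T $$ (i, j)"
    proof (cases i j rule: linorder_cases)
      case less
      let ?d = "csqrt (T $$ (i, i)) + csqrt (T $$ (j, j))"
      \<comment> \<open>Principal roots of numbers off the cut have positive real part, so the
        denominator of the recursion is nonzero.\<close>
      have "0 < Re ?d" using Re_csqrt_pos slit ij by (simp add: add_pos_pos)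
      then have d: "?d \<noteq> 0" by (metis less_irrefl zero_complex.sel(1))
      have "{i..j} = insert i (insert j {i<..<j})" using less by auto
      then have "(\<Sum>k\<in>{i..j}. ?s i k * ?s k j)
          = ?s i j * ?d + (\<Sum>k\<in>{i<..<j}. ?s i k * ?s k j)"
        using less by (simp add: diag algebra_simps)
      also have "?s i j * ?d = T $$ (i, j) - (\<Sum>k\<in>{i<..<j}. ?s i k * ?s k j)"
        using less d by (subst tri_sqrt_entry.simps) simp
      finally show ?thesis by simp
    next
      case equal
      then show ?thesis using power2_csqrt[of "T $$ (j, j)"] by (simp add: diag power2_eq_square)
    next
      case greater
      then show ?thesis using T ij by (auto simp: upper_triangularD)
    qed
    finally show "(S * S) $$ (i, j) = T $$ (i, j)" .
  qed (use S T in auto)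
  moreover have "\<And>i. i < n \<Longrightarrow> S $$ (i, i) = csqrt (T $$ (i, i))" by (simp add: S_def diag)
  ultimately show ?thesis using that S ut by blast
qed

section \<open>Existence and uniqueness of the principal square root\<close>

lemma slit_sqrt_exists:
  assumes A: "A \<in> carrier_mat n n" and slit: "slit_spectrum A"
  obtains S where "S \<in> carrier_mat n n" "S * S = A" "\<And>k. eigenvalue S k \<Longrightarrow> 0 < Re k"
proof -
  obtain P T Q where PTQ: "P \<in> carrier_mat n n" "T \<in> carrier_mat n n" "Q \<in> carrier_mat n n"
    "P * Q = 1\<^sub>m n" "Q * P = 1\<^sub>m n" "A = P * T * Q" "upper_triangular T"
    "\<And>i. i < n \<Longrightarrow> eigenvalue A (T $$ (i, i))"
    using schur_triangularization[OF A] by metis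
  then have Tslit: "\<And>i. i < n \<Longrightarrow> T $$ (i, i) \<notin> \<real>\<^sub>\<le>\<^sub>0" using slit unfolding slit_spectrum_def by blast
  obtain R where R: "R \<in> carrier_mat n n" "upper_triangular R" "R * R = T"
    "\<And>i. i < n \<Longrightarrow> R $$ (i, i) = csqrt (T $$ (i, i))"
    using upper_triangular_sqrt[OF PTQ(2,7) Tslit] by metis
  let ?S = "P * R * Q"
  note [simp] = assoc_mult_mat[of _ n n _ n _ n]
  have S: "?S \<in> carrier_mat n n" using PTQ R by auto
  \<comment> \<open>The inner factor \<open>Q * P\<close> is the identity, so conjugation carries
    the root of \<open>T\<close> to a root of \<open>A\<close>.\<close>
  have "?S * ?S = P * (R * ((Q * P) * (R * Q)))" using PTQ(1-3) R(1) by simp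
  also have "\<dots> = P * ((R * R) * Q)" unfolding PTQ(5) using PTQ(1-3) R(1) by simp
  also have "\<dots> = A" unfolding R(3) PTQ(6) using PTQ(1-3) by simp
  finally have "?S * ?S = A" .
  moreover have "similar_mat ?S R"
    using PTQ R S by (intro similar_matI[of _ _ P Q n]) auto
  then have "0 < Re k" if "eigenvalue ?S k" for k
    using that Tslit R PTQ(2) Re_csqrt_pos
    unfolding eigenvalue_similar[OF S R(1) \<open>similar_mat ?S R\<close>] eigenvalue_upper_triangular[OF R(1,2)]
    by (auto simp: diag_mat_def)
  ultimately show ?thesis using that S by blast
qed

text \<open>After triangularising \<open>R\<close>, the columns of \<open>Y = X P\<close> vanish
  successively: once the earlier ones are zero, column \<open>j\<close> satisfies
  \<open>S y = - T $$ (j, j) y\<close>, and \<open>ev\<close> keeps this number out of the spectrum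
  of \<open>S\<close>.\<close>

lemma sylvester_zero:
  fixes S R X :: "complex mat"
  assumes S: "S \<in> carrier_mat n n" and R: "R \<in> carrier_mat n n" and X: "X \<in> carrier_mat n n"
    and eq: "S * X = - (X * R)"
    and ev: "\<And>k l. eigenvalue S k \<Longrightarrow> eigenvalue R l \<Longrightarrow> k \<noteq> - l"
  shows "X = 0\<^sub>m n n"
proof -
  obtain P T Q where PTQ: "P \<in> carrier_mat n n" "T \<in> carrier_mat n n" "Q \<in> carrier_mat n n"
    "P * Q = 1\<^sub>m n" "Q * P = 1\<^sub>m n" "R = P * T * Q" "upper_triangular T"
    "\<And>i. i < n \<Longrightarrow> eigenvalue R (T $$ (i, i))"
    using schur_triangularization[OF R] by metis
  define Y where "Y = X * P"
  have Y: "Y \<in> carrier_mat n n" unfolding Y_def using X PTQ by auto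
  have RP: "R * P = P * T"
  proof -
    have "R * P = P * T * (Q * P)" unfolding PTQ(6) using PTQ(1-3)
      by (simp add: assoc_mult_mat[of _ n n _ n _ n])
    then show ?thesis unfolding PTQ(5) using PTQ(1,2) by simp
  qed
  have "S * Y = (S * X) * P" unfolding Y_def using S X PTQ(1)
    by (simp add: assoc_mult_mat[of _ n n _ n _ n])
  also have "\<dots> = - (X * (R * P))" unfolding eq using X R PTQ(1)
    by (simp add: assoc_mult_mat[of _ n n _ n _ n])
  also have "\<dots> = - (Y * T)" unfolding RP Y_def using X PTQ(1,2)
    by (simp add: assoc_mult_mat[of _ n n _ n _ n])
  finally have SY: "S * Y = - (Y * T)" .
  have "\<forall>i<n. Y $$ (i, j) = 0" if "j < n" for j
    using that
  proof (induction j rule: less_induct)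
    case (less j)
    let ?c = "Matrix.col Y j"
    have c: "?c \<in> carrier_vec n" using Y by auto
    have "vec_index (S *\<^sub>v ?c) i = vec_index ((- (T $$ (j, j))) \<cdot>\<^sub>v ?c) i" if i: "i < n" for i
    proof -
      have "vec_index (S *\<^sub>v ?c) i = (S * Y) $$ (i, j)"
        using S Y i less.prems by simp
      also have "\<dots> = - (\<Sum>k<n. Y $$ (i, k) * T $$ (k, j))"
        unfolding SY using Y PTQ(2) i less.prems by (simp add: scalar_prod_def atLeast0LessThan)
      \<comment> \<open>Terms with \<open>k < j\<close> vanish by induction, those with
        \<open>k > j\<close> because \<open>T\<close> is triangular.\<close>
      also have "(\<Sum>k<n. Y $$ (i, k) * T $$ (k, j)) = (\<Sum>k\<in>{j}. Y $$ (i, k) * T $$ (k, j))"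
      proof (rule sum.mono_neutral_right)
        show "\<forall>k\<in>{..<n} - {j}. Y $$ (i, k) * T $$ (k, j) = 0"
        proof
          fix k assume k: "k \<in> {..<n} - {j}"
          then consider "k < j" | "j < k" by force
          then show "Y $$ (i, k) * T $$ (k, j) = 0"
            using less k i PTQ(2,7) by cases (auto simp: upper_triangularD)
        qed
      qed (use less.prems in auto)
      finally show ?thesis using Y i less.prems by simp
    qed
    then have "S *\<^sub>v ?c = (- (T $$ (j, j))) \<cdot>\<^sub>v ?c"
      using S Y by (intro eq_vecI) auto
    moreover have "\<not> eigenvalue S (- (T $$ (j, j)))"
      using ev PTQ(8)[OF less.prems] by force
    ultimately have "?c = 0\<^sub>v n"
      using c S unfolding eigenvalue_def eigenvector_def by auto
    show ?case
    proof (intro allI impI)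
      fix i assume i: "i < n"
      then have "Y $$ (i, j) = vec_index ?c i" using Y less.prems by simp
      then show "Y $$ (i, j) = 0" using i \<open>?c = 0\<^sub>v n\<close> by simp
    qed
  qed
  then have "Y = 0\<^sub>m n n" using Y by (intro eq_matI) auto
  moreover have "X = Y * Q"
    unfolding Y_def using X PTQ by (simp add: assoc_mult_mat[of _ n n _ n _ n])
  ultimately show ?thesis using PTQ by simp
qed

text \<open>If \<open>S * S = R * R\<close>, then \<open>X = S - R\<close> satisfies the Sylvester equation \<open>S X = - X R\<close>.\<close>

lemma sqrt_unique:
  assumes S: "S \<in> carrier_mat n n" "\<And>k. eigenvalue S k \<Longrightarrow> 0 < Re k"
    and R: "R \<in> carrier_mat n n" "\<And>k. eigenvalue R k \<Longrightarrow> 0 < Re k"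
    and eq: "S * S = R * R"
  shows "S = R"
proof -
  have X: "S - R \<in> carrier_mat n n" using S R by auto
  have ev: "k \<noteq> - l" if "eigenvalue S k" "eigenvalue R l" for k l
    using S(2)[OF that(1)] R(2)[OF that(2)] by auto
  have "S * (S - R) = R * R - S * R"
    using S R by (simp add: mult_minus_distrib_mat[of _ n n _ n] eq)
  moreover have "(S - R) * R = S * R - R * R"
    using S R by (simp add: minus_mult_distrib_mat[of _ n n _ _ n])
  moreover have "R * R - S * R = - (S * R - R * R)"
    using S(1) R(1) by (intro eq_matI) (auto simp del: index_mult_mat(1))
  ultimately have "S * (S - R) = - ((S - R) * R)" by simp
  from sylvester_zero[OF S(1) R(1) X this ev] have z: "S - R = 0\<^sub>m n n" .
  show ?thesis
  proof (rule eq_matI)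
    fix i j assume "i < dim_row R" "j < dim_col R"
    then have ij: "i < n" "j < n" using R by auto
    then have "(S - R) $$ (i, j) = S $$ (i, j) - R $$ (i, j)"
      using S R by simp
    moreover have "(S - R) $$ (i, j) = 0" unfolding z using ij by simp
    ultimately show "S $$ (i, j) = R $$ (i, j)" by simp
  qed (use S R in auto)
qed

text \<open>Existence and uniqueness together evaluate the definite description in
  \<open>principal_sqrt\<close>.\<close>

lemma principal_sqrt_facts:
  assumes A: "A \<in> carrier_mat n n" and slit: "slit_spectrum A"
  shows "principal_sqrt A \<in> carrier_mat n n" "principal_sqrt A * principal_sqrt A = A"
proof -
  obtain S where S: "S \<in> carrier_mat n n" "S * S = A" "\<And>k. eigenvalue S k \<Longrightarrow> 0 < Re k"
    using slit_sqrt_exists[OF assms] by metis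
  have dim: "dim_row A = n" using A by simp
  have "principal_sqrt A = S"
    unfolding principal_sqrt_def dim
  proof (rule the_equality)
    fix R assume R: "R \<in> carrier_mat n n \<and> R * R = A \<and> (\<forall>k. eigenvalue R k \<longrightarrow> 0 < Re k)"
    show "R = S" by (rule sqrt_unique[of R n S]) (use R S in auto)
  qed (use S in blast)
  then show "principal_sqrt A \<in> carrier_mat n n" "principal_sqrt A * principal_sqrt A = A"
    using S by auto
qed

text \<open>If \<open>B w = r A w\<close> with real \<open>r \<le> 0\<close>, two positive forms at
  \<open>w\<close> would differ by a nonpositive factor. The hypothesis \<open>pencil\<close> admits
  both an accretive matrix compared with the identity and the congruence arising in the
  mean.\<close>

lemma slit_spectrum_generalized:
  assumes A: "A \<in> carrier_mat n n" "accretive A" and X: "X \<in> carrier_mat n n"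
    and B: "B \<in> carrier_mat n n" "accretive B"
    and pencil: "\<And>k v. v \<in> carrier_vec n \<Longrightarrow> v \<noteq> 0\<^sub>v n \<Longrightarrow> X *\<^sub>v v = k \<cdot>\<^sub>v v \<Longrightarrow>
      \<exists>w\<in>carrier_vec n. w \<noteq> 0\<^sub>v n \<and> B *\<^sub>v w = k \<cdot>\<^sub>v (A *\<^sub>v w)"
  shows "slit_spectrum X"
  unfolding slit_spectrum_def
proof (intro allI impI notI)
  fix k assume "eigenvalue X k" and k: "k \<in> \<real>\<^sub>\<le>\<^sub>0"
  then obtain v where "v \<in> carrier_vec n" "v \<noteq> 0\<^sub>v n" "X *\<^sub>v v = k \<cdot>\<^sub>v v"
    using X unfolding eigenvalue_def eigenvector_def by auto
  then obtain w where w: "w \<in> carrier_vec n" "w \<noteq> 0\<^sub>v n" "B *\<^sub>v w = k \<cdot>\<^sub>v (A *\<^sub>v w)"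
    using pencil by blast
  obtain r where r: "k = complex_of_real r" "r \<le> 0" using k by (auto simp: nonpos_Reals_def)
  have "A *\<^sub>v w \<in> carrier_vec n" using A w by auto
  then have "qform B w = r * qform A w"
    unfolding qform_def w(3) r(1) using w(1) by simp
  moreover have "0 < qform B w" "0 < qform A w" using w A B accretive_iff by blast+
  ultimately show False using r(2) by (simp add: mult_le_0_iff zero_less_mult_iff)
qed

lemma accretive_slit_spectrum:
  assumes A: "A \<in> carrier_mat n n" "accretive A"
  shows "slit_spectrum A"
proof (rule slit_spectrum_generalized)
  show "accretive (1\<^sub>m n)"
    by (auto simp: accretive_iff[of _ n] qform_def)
      (metis conjugate_square_greater_0_vec less_complex_def zero_complex.sel(1))
qed (use A in auto)

section \<open>Entrywise integrals\<close>

definition continuous_entries :: "nat \<Rightarrow> real set \<Rightarrow> (real \<Rightarrow> complex mat) \<Rightarrow> bool" where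
  "continuous_entries n K F \<longleftrightarrow> (\<forall>t\<in>K. F t \<in> carrier_mat n n) \<and>
    (\<forall>i<n. \<forall>j<n. continuous_on K (\<lambda>t. F t $$ (i, j)))"

text \<open>The Leibniz formula makes the determinant a polynomial in the entries.\<close>

lemma continuous_on_det:
  assumes "continuous_entries n K F"
  shows "continuous_on K (\<lambda>t. Determinant.det (F t))"
proof -
  have "continuous_on K (\<lambda>t. \<Sum>p\<in>{p. p permutes {0..<n}}. signof p * (\<Prod>i = 0..<n. F t $$ (i, p i)))"
  proof (intro continuous_on_sum continuous_on_mult continuous_on_const continuous_on_prod)
    fix p i assume "p \<in> {p. p permutes {0..<n}}" "i \<in> {0..<n}"
    then have "p i \<in> {0..<n}" by (simp add: permutes_in_image)
    with \<open>i \<in> _\<close> show "continuous_on K (\<lambda>t. F t $$ (i, p i))"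
      using assms unfolding continuous_entries_def by auto
  qed
  then show ?thesis
    using assms unfolding continuous_entries_def
    by (subst continuous_on_cong[OF refl det_def']) auto
qed

text \<open>Cramer's rule, with its transposed cofactor indices; it reduces continuity of the
  inverse to that of determinants.\<close>

lemma minv_conv_cofactor:
  assumes A: "A \<in> carrier_mat n n" and d: "Determinant.det A \<noteq> 0"
    and ij: "i < n" "j < n"
  shows "minv A $$ (i, j) = cofactor A j i / Determinant.det A"
proof -
  note a = adj_mat[OF A]
  have "minv A = (1 / Determinant.det A) \<cdot>\<^sub>m adj_mat A"
  proof (rule minv_unique[OF A])
    show "A * ((1 / Determinant.det A) \<cdot>\<^sub>m adj_mat A) = 1\<^sub>m n"
      unfolding mult_smult_distrib[OF A a(1)] a(2) using d by (intro eq_matI) auto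
  qed (use a(1) in auto)
  then show ?thesis using A ij by (simp add: adj_mat_def)
qed

lemma continuous_entries_minv:
  assumes F: "continuous_entries n K F" and d: "\<And>t. t \<in> K \<Longrightarrow> Determinant.det (F t) \<noteq> 0"
  shows "continuous_entries n K (\<lambda>t. minv (F t))"
  unfolding continuous_entries_def
proof (intro conjI ballI allI impI)
  have c: "F t \<in> carrier_mat n n" if "t \<in> K" for t
    using F that unfolding continuous_entries_def by blast
  show "minv (F t) \<in> carrier_mat n n" if "t \<in> K" for t
    using minv_inverse(1)[OF c d] that by blast
  fix i j assume ij: "i < n" "j < n"
  have "continuous_entries (n - 1) K (\<lambda>t. mat_delete (F t) j i)"
    unfolding continuous_entries_def
  proof (intro conjI ballI allI impI)
    show "mat_delete (F t) j i \<in> carrier_mat (n - 1) (n - 1)" if "t \<in> K" for t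
      using c[OF that] by (intro carrier_matI) auto
    fix a b assume ab: "a < n - 1" "b < n - 1"
    \<comment> \<open>Deleting row \<open>j\<close> and column \<open>i\<close> shifts the indices
      from there on by one.\<close>
    let ?a = "if a < j then a else Suc a" and ?b = "if b < i then b else Suc b"
    have "continuous_on K (\<lambda>t. F t $$ (?a, ?b))"
      using F ab unfolding continuous_entries_def by auto
    moreover have "mat_delete (F t) j i $$ (a, b) = F t $$ (?a, ?b)" if "t \<in> K" for t
      using c[OF that] ab unfolding mat_delete_def by auto
    ultimately show "continuous_on K (\<lambda>t. mat_delete (F t) j i $$ (a, b))"
      by (simp cong: continuous_on_cong)
  qed
  then have "continuous_on K (\<lambda>t. cofactor (F t) j i / Determinant.det (F t))"
    unfolding cofactor_def using d
    by (intro continuous_on_divide continuous_on_mult continuous_on_const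
        continuous_on_det[OF F] continuous_on_det) auto
  then show "continuous_on K (\<lambda>t. minv (F t) $$ (i, j))"
    using minv_conv_cofactor[OF c d ij] by (simp cong: continuous_on_cong)
qed

lemma continuous_entries_const: "A \<in> carrier_mat n n \<Longrightarrow> continuous_entries n K (\<lambda>_. A)"
  by (simp add: continuous_entries_def)

lemma continuous_entries_add:
  assumes "continuous_entries n K F" "continuous_entries n K G"
  shows "continuous_entries n K (\<lambda>t. F t + G t)"
proof -
  have "continuous_on K (\<lambda>t. (F t + G t) $$ (i, j))" if "i < n" "j < n" for i j
  proof -
    have "continuous_on K (\<lambda>t. F t $$ (i, j) + G t $$ (i, j))"
      using assms that unfolding continuous_entries_def by (intro continuous_on_add) auto
    moreover have "(F t + G t) $$ (i, j) = F t $$ (i, j) + G t $$ (i, j)" if "t \<in> K" for t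
      using assms that \<open>i < n\<close> \<open>j < n\<close> unfolding continuous_entries_def by fastforce
    ultimately show ?thesis by (simp cong: continuous_on_cong)
  qed
  then show ?thesis using assms unfolding continuous_entries_def by auto
qed

lemma continuous_entries_smult:
  assumes "continuous_entries n K F" "continuous_on K c"
  shows "continuous_entries n K (\<lambda>t. complex_of_real (c t) \<cdot>\<^sub>m F t)"
proof -
  have "continuous_on K (\<lambda>t. (complex_of_real (c t) \<cdot>\<^sub>m F t) $$ (i, j))" if "i < n" "j < n" for i j
  proof -
    have "continuous_on K (\<lambda>t. complex_of_real (c t) * F t $$ (i, j))"
      using assms that unfolding continuous_entries_def
      by (intro continuous_on_mult continuous_on_of_real) auto
    moreover have "(complex_of_real (c t) \<cdot>\<^sub>m F t) $$ (i, j) = complex_of_real (c t) * F t $$ (i, j)"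
      if "t \<in> K" for t
      using assms that \<open>i < n\<close> \<open>j < n\<close> unfolding continuous_entries_def by fastforce
    ultimately show ?thesis by (simp cong: continuous_on_cong)
  qed
  then show ?thesis using assms unfolding continuous_entries_def by auto
qed

lemma continuous_entries_diff:
  assumes "continuous_entries n K F" "continuous_entries n K G"
  shows "continuous_entries n K (\<lambda>t. F t - G t)"
proof -
  have "continuous_on K (\<lambda>t. (F t - G t) $$ (i, j))" if "i < n" "j < n" for i j
  proof -
    have "continuous_on K (\<lambda>t. F t $$ (i, j) - G t $$ (i, j))"
      using assms that unfolding continuous_entries_def by (intro continuous_on_diff) auto
    moreover have "(F t - G t) $$ (i, j) = F t $$ (i, j) - G t $$ (i, j)" if "t \<in> K" for t
      using assms that \<open>i < n\<close> \<open>j < n\<close> unfolding continuous_entries_def by fastforce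
    ultimately show ?thesis by (simp cong: continuous_on_cong)
  qed
  then show ?thesis using assms unfolding continuous_entries_def by (auto intro!: minus_carrier_mat)
qed

section \<open>Integrability and order properties of entrywise integrals\<close>

definition integrable_entries :: "nat \<Rightarrow> real measure \<Rightarrow> (real \<Rightarrow> complex mat) \<Rightarrow> bool" where
  "integrable_entries n \<nu> F \<longleftrightarrow> (\<forall>i<n. \<forall>j<n. integrable \<nu> (\<lambda>t. F t $$ (i, j)))"

text \<open>A continuous entry is bounded on the compact interval, hence integrable for a finite
  measure. Integrability is tracked because a Bochner integral defaults to zero without it.\<close>

lemma continuous_entries_integrable:
  assumes "finite_measure \<nu>" and sets: "sets \<nu> = sets (restrict_space borel {0..1})"
    and F: "continuous_entries n {0..1} F"
  shows "integrable_entries n \<nu> F"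
  unfolding integrable_entries_def
proof (intro allI impI)
  fix i j assume ij: "i < n" "j < n"
  interpret finite_measure \<nu> by fact
  have cont: "continuous_on {0..1} (\<lambda>t. F t $$ (i, j))"
    using F ij unfolding continuous_entries_def by blast
  have space: "space \<nu> = {0..1}"
    using sets_eq_imp_space_eq[OF sets] by (simp add: space_restrict_space)
  have "bounded ((\<lambda>t. F t $$ (i, j)) ` {0..1})"
    using cont by (intro compact_imp_bounded compact_continuous_image) auto
  then obtain b where b: "\<forall>t\<in>{0..1}. norm (F t $$ (i, j)) \<le> b" by (auto simp: bounded_iff)
  show "integrable \<nu> (\<lambda>t. F t $$ (i, j))"
  proof (rule integrable_const_bound[of _ b])
    show "AE t in \<nu>. norm (F t $$ (i, j)) \<le> b"
      using b space by (intro AE_I2) auto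
    show "(\<lambda>t. F t $$ (i, j)) \<in> borel_measurable \<nu>"
      using borel_measurable_continuous_on_restrict[OF cont] measurable_cong_sets[OF sets refl]
      by blast
  qed
qed

lemma mat_integral_carrier [simp]: "mat_integral n \<nu> F \<in> carrier_mat n n"
  by (simp add: mat_integral_def)

lemma mat_integral_cong:
  assumes "\<And>t. t \<in> space \<nu> \<Longrightarrow> F t = G t"
  shows "mat_integral n \<nu> F = mat_integral n \<nu> G"
  using assms unfolding mat_integral_def by (intro eq_matI) (auto intro!: Bochner_Integration.integral_cong)

text \<open>The common pattern behind quadratic forms and two-sided products: both are fixed linear
  combinations of the entries.\<close>

lemma integral_double_sum:
  fixes f :: "nat \<Rightarrow> nat \<Rightarrow> real \<Rightarrow> complex"
  assumes "\<And>i j. i < n \<Longrightarrow> j < n \<Longrightarrow> integrable \<nu> (f i j)"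
  shows "integrable \<nu> (\<lambda>t. \<Sum>i<n. \<Sum>j<n. f i j t * c i j)"
    and "(\<integral>t. (\<Sum>i<n. \<Sum>j<n. f i j t * c i j) \<partial>\<nu>) = (\<Sum>i<n. \<Sum>j<n. (\<integral>t. f i j t \<partial>\<nu>) * c i j)"
proof -
  have int: "integrable \<nu> (\<lambda>t. f i j t * c i j)" if "i < n" "j < n" for i j
    using assms[OF that] by simp
  have row: "integrable \<nu> (\<lambda>t. \<Sum>j<n. f i j t * c i j)" if "i < n" for i
    using that int by (intro Bochner_Integration.integrable_sum) auto
  from row show "integrable \<nu> (\<lambda>t. \<Sum>i<n. \<Sum>j<n. f i j t * c i j)"
    by (rule Bochner_Integration.integrable_sum) simp
  have "(\<integral>t. (\<Sum>i<n. \<Sum>j<n. f i j t * c i j) \<partial>\<nu>) = (\<Sum>i<n. \<integral>t. (\<Sum>j<n. f i j t * c i j) \<partial>\<nu>)"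
    using row by (intro Bochner_Integration.integral_sum) auto
  also have "\<dots> = (\<Sum>i<n. \<Sum>j<n. (\<integral>t. f i j t * c i j \<partial>\<nu>))"
    using int by (intro sum.cong refl Bochner_Integration.integral_sum) auto
  finally show "(\<integral>t. (\<Sum>i<n. \<Sum>j<n. f i j t * c i j) \<partial>\<nu>) = (\<Sum>i<n. \<Sum>j<n. (\<integral>t. f i j t \<partial>\<nu>) * c i j)"
    by simp
qed

lemma qform_mat_integral:
  assumes F: "integrable_entries n \<nu> F" "\<And>t. t \<in> space \<nu> \<Longrightarrow> F t \<in> carrier_mat n n"
    and v: "v \<in> carrier_vec n"
  shows "integrable \<nu> (\<lambda>t. qform (F t) v)"
    and "qform (mat_integral n \<nu> F) v = (\<integral>t. qform (F t) v \<partial>\<nu>)"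
proof -
  let ?g = "\<lambda>t. \<Sum>i<n. \<Sum>j<n. F t $$ (i, j) * (vec_index v j * cnj (vec_index v i))"
  have e: "qform (F t) v = Re (?g t)" if "t \<in> space \<nu>" for t
    using qform_conv_sum[OF F(2)[OF that] v] .
  have g: "integrable \<nu> ?g"
    using F(1) unfolding integrable_entries_def by (intro integral_double_sum(1)) auto
  then have "integrable \<nu> (\<lambda>t. Re (?g t))" by (rule integrable_Re)
  then show "integrable \<nu> (\<lambda>t. qform (F t) v)"
    by (subst Bochner_Integration.integrable_cong[OF refl e]) auto
  have "qform (mat_integral n \<nu> F) v = Re (\<integral>t. ?g t \<partial>\<nu>)"
    unfolding qform_conv_sum[OF mat_integral_carrier v]
    using F(1) unfolding integrable_entries_def
    by (subst integral_double_sum(2)) (auto simp: mat_integral_def)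
  also have "\<dots> = (\<integral>t. Re (?g t) \<partial>\<nu>)" using integral_Re[OF g] by (rule sym)
  also have "\<dots> = (\<integral>t. qform (F t) v \<partial>\<nu>)"
    using e by (intro Bochner_Integration.integral_cong) auto
  finally show "qform (mat_integral n \<nu> F) v = (\<integral>t. qform (F t) v \<partial>\<nu>)" .
qed

lemma hermitian_mat_integral:
  assumes "\<And>t. t \<in> space \<nu> \<Longrightarrow> F t \<in> carrier_mat n n" "\<And>t. t \<in> space \<nu> \<Longrightarrow> hermitian_mat (F t)"
  shows "hermitian_mat (mat_integral n \<nu> F)"
proof -
  have "cnj (\<integral>t. F t $$ (j, i) \<partial>\<nu>) = (\<integral>t. F t $$ (i, j) \<partial>\<nu>)" if "i < n" "j < n" for i j
  proof -
    have "cnj (\<integral>t. F t $$ (j, i) \<partial>\<nu>) = (\<integral>t. cnj (F t $$ (j, i)) \<partial>\<nu>)" by simp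
    also have "\<dots> = (\<integral>t. F t $$ (i, j) \<partial>\<nu>)"
      using hermitian_mat_iff[OF assms(1)] assms(2) that
      by (intro Bochner_Integration.integral_cong) auto
    finally show ?thesis .
  qed
  then show ?thesis
    unfolding hermitian_mat_iff[OF mat_integral_carrier] by (simp add: mat_integral_def)
qed

text \<open>Two-sided multiplication is linear in the entries; this pulls the factors
  \<open>minv S\<close> of the mean out of the integral.\<close>

lemma mat_integral_mult:
  assumes F: "integrable_entries n \<nu> F" "\<And>t. t \<in> space \<nu> \<Longrightarrow> F t \<in> carrier_mat n n"
    and L: "L \<in> carrier_mat n n" and R: "R \<in> carrier_mat n n"
  shows "L * mat_integral n \<nu> F * R = mat_integral n \<nu> (\<lambda>t. L * F t * R)"
proof (rule eq_matI)
  have entry: "(L * X * R) $$ (i, j) = (\<Sum>k<n. \<Sum>l<n. X $$ (l, k) * (L $$ (i, l) * R $$ (k, j)))"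
    if "X \<in> carrier_mat n n" "i < n" "j < n" for X i j
    using that L R
    by (subst sum.swap)
      (simp add: scalar_prod_def atLeast0LessThan sum_distrib_right sum_distrib_left mult_ac)
  fix i j
  assume "i < dim_row (mat_integral n \<nu> (\<lambda>t. L * F t * R))"
    "j < dim_col (mat_integral n \<nu> (\<lambda>t. L * F t * R))"
  then have ij: "i < n" "j < n" by (auto simp: mat_integral_def)
  have "(L * mat_integral n \<nu> F * R) $$ (i, j)
      = (\<Sum>k<n. \<Sum>l<n. (\<integral>t. F t $$ (l, k) \<partial>\<nu>) * (L $$ (i, l) * R $$ (k, j)))"
    unfolding entry[OF mat_integral_carrier ij] by (simp add: mat_integral_def)
  also have "\<dots> = (\<integral>t. (\<Sum>k<n. \<Sum>l<n. F t $$ (l, k) * (L $$ (i, l) * R $$ (k, j))) \<partial>\<nu>)"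
    using F(1) unfolding integrable_entries_def by (subst integral_double_sum(2)) auto
  also have "\<dots> = (\<integral>t. (L * F t * R) $$ (i, j) \<partial>\<nu>)"
    using entry F(2) ij by (intro Bochner_Integration.integral_cong) auto
  also have "\<dots> = mat_integral n \<nu> (\<lambda>t. L * F t * R) $$ (i, j)"
    using ij by (simp add: mat_integral_def)
  finally show "(L * mat_integral n \<nu> F * R) $$ (i, j)
    = mat_integral n \<nu> (\<lambda>t. L * F t * R) $$ (i, j)" .
qed (use L R in \<open>auto simp: mat_integral_def\<close>)

text \<open>For fixed \<open>v\<close> this is monotonicity of a scalar integral, since the form
  commutes with integration.\<close>

lemma mat_integral_mono:
  assumes F: "integrable_entries n \<nu> F" "\<And>t. t \<in> space \<nu> \<Longrightarrow> F t \<in> carrier_mat n n"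
    and G: "integrable_entries n \<nu> G" "\<And>t. t \<in> space \<nu> \<Longrightarrow> G t \<in> carrier_mat n n"
    and le: "\<And>t v. t \<in> space \<nu> \<Longrightarrow> v \<in> carrier_vec n \<Longrightarrow> qform (F t) v \<le> qform (G t) v"
    and v: "v \<in> carrier_vec n"
  shows "qform (mat_integral n \<nu> F) v \<le> qform (mat_integral n \<nu> G) v"
proof -
  have "integrable \<nu> (\<lambda>t. qform (F t) v)" "integrable \<nu> (\<lambda>t. qform (G t) v)"
    using F G v by (auto intro: qform_mat_integral(1))
  then have "(\<integral>t. qform (F t) v \<partial>\<nu>) \<le> (\<integral>t. qform (G t) v \<partial>\<nu>)"
    using le v by (intro Bochner_Integration.integral_mono) auto
  then show ?thesis
    using F G v by (simp add: qform_mat_integral(2))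
qed

section \<open>The mean as an integral of harmonic means\<close>

lemma wharm_inverse_facts:
  assumes A: "A \<in> carrier_mat n n" "accretive A" and B: "B \<in> carrier_mat n n" "accretive B"
    and t: "0 \<le> t" "t \<le> 1"
  defines "Z \<equiv> complex_of_real (1 - t) \<cdot>\<^sub>m minv A + complex_of_real t \<cdot>\<^sub>m minv B"
  shows "Z \<in> carrier_mat n n" "accretive Z"
proof -
  have "minv A \<in> carrier_mat n n" "minv B \<in> carrier_mat n n"
    using A B by (auto intro: accretive_minv_carrier)
  then show "Z \<in> carrier_mat n n" "accretive Z"
    unfolding Z_def using accretive_convex accretive_minv A B t by auto
qed

lemma wharm_carrier:
  assumes "A \<in> carrier_mat n n" "accretive A" "B \<in> carrier_mat n n" "accretive B"
    and "0 \<le> t" "t \<le> 1"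
  shows "wharm t A B \<in> carrier_mat n n"
  unfolding wharm_def
  by (rule minv_inverse(1)[OF wharm_inverse_facts(1)[OF assms]
      accretive_det_nonzero[OF wharm_inverse_facts[OF assms]]])

lemma continuous_entries_wharm_inverse:
  assumes "A \<in> carrier_mat n n" "accretive A" "B \<in> carrier_mat n n" "accretive B"
  shows "continuous_entries n {0..1}
    (\<lambda>t. complex_of_real (1 - t) \<cdot>\<^sub>m minv A + complex_of_real t \<cdot>\<^sub>m minv B)"
  using assms
  by (intro continuous_entries_add continuous_entries_smult continuous_entries_const continuous_intros)
    (auto intro: accretive_minv_carrier)

lemma continuous_entries_wharm:
  assumes "A \<in> carrier_mat n n" "accretive A" "B \<in> carrier_mat n n" "accretive B"
  shows "continuous_entries n {0..1} (\<lambda>t. wharm t A B)"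
  unfolding wharm_def
proof (rule continuous_entries_minv[OF continuous_entries_wharm_inverse[OF assms]])
  fix t :: real assume "t \<in> {0..1}"
  then show "Determinant.det (complex_of_real (1 - t) \<cdot>\<^sub>m minv A + complex_of_real t \<cdot>\<^sub>m minv B) \<noteq> 0"
    using wharm_inverse_facts[OF assms, of t] accretive_det_nonzero by auto
qed

text \<open>With \<open>T = minv S\<close> the identity is \<open>T A T\<close>, so the claim is
  invariance of the harmonic mean under \<open>X \<mapsto> T X T\<close>. As \<open>S\<close> need
  not be Hermitian, the same factor stands on both sides instead of an adjoint.\<close>

lemma wharm_congruence:
  assumes S: "S \<in> carrier_mat n n" "S * S = A" and A: "A \<in> carrier_mat n n" "accretive A"
    and B: "B \<in> carrier_mat n n" "accretive B" and t: "0 \<le> t" "t \<le> 1"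
  shows "wharm t (1\<^sub>m n) (minv S * B * minv S) = minv S * wharm t A B * minv S"
proof -
  note [simp] = assoc_mult_mat[of _ n n _ n _ n]
  have "Determinant.det S \<noteq> 0"
    using accretive_det_nonzero[OF A] det_mult[OF S(1) S(1)] S(2) by auto
  note iS = minv_inverse[OF S(1) this]
  note iA = minv_inverse[OF A(1) accretive_det_nonzero[OF A]]
  note iB = minv_inverse[OF B(1) accretive_det_nonzero[OF B]]
  let ?T = "minv S"
  \<comment> \<open>These rules cancel adjacent inverse pairs inside right-associated
    products.\<close>
  have cancel: "S * (?T * X) = X" "?T * (S * X) = X" if "X \<in> carrier_mat n n" for X
    using iS S(1) that by (simp_all flip: assoc_mult_mat[of _ n n _ n _ n])
  have cancelB: "B * (minv B * X) = X" if "X \<in> carrier_mat n n" for X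
    using iB B(1) that by (simp flip: assoc_mult_mat[of _ n n _ n _ n])
  have "minv (?T * B * ?T) = S * minv B * S"
  proof (rule minv_unique)
    show "?T * B * ?T * (S * minv B * S) = 1\<^sub>m n"
      using iS S(1) iB B(1) by (simp add: cancel cancelB)
  qed (use iS S iB B in auto)
  \<comment> \<open>Writing the identity in this way lets \<open>S\<close> be factored out of both
    summands.\<close>
  moreover have "S * minv A * S = 1\<^sub>m n"
  proof -
    have "minv A = ?T * ?T"
      unfolding S(2)[symmetric]
      by (rule minv_unique[of _ n]) (use iS S(1) in \<open>auto simp: cancel\<close>)
    then show ?thesis using iS S(1) by (simp add: cancel)
  qed
  ultimately have "complex_of_real (1 - t) \<cdot>\<^sub>m minv (1\<^sub>m n) + complex_of_real t \<cdot>\<^sub>m minv (?T * B * ?T)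
      = complex_of_real (1 - t) \<cdot>\<^sub>m (S * minv A * S) + complex_of_real t \<cdot>\<^sub>m (S * minv B * S)"
    by simp
  also have "\<dots> = S * (complex_of_real (1 - t) \<cdot>\<^sub>m minv A + complex_of_real t \<cdot>\<^sub>m minv B) * S"
    using S(1) iA(1) iB(1)
    by (simp add: mult_add_distrib_mat[of _ n n _ n] add_mult_distrib_mat[of _ n n _ _ n]
        mult_smult_distrib[of _ n n _ n] mult_smult_assoc_mat[of _ n n _ n] del: of_real_diff)
  finally have e: "complex_of_real (1 - t) \<cdot>\<^sub>m minv (1\<^sub>m n) + complex_of_real t \<cdot>\<^sub>m minv (?T * B * ?T)
      = S * (complex_of_real (1 - t) \<cdot>\<^sub>m minv A + complex_of_real t \<cdot>\<^sub>m minv B) * S" (is "_ = S * ?Z * S") .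
  have Z: "?Z \<in> carrier_mat n n" "accretive ?Z" using wharm_inverse_facts[OF A B t] .
  note iZ = minv_inverse[OF Z(1) accretive_det_nonzero[OF Z]]
  have cancelZ: "?Z * (minv ?Z * X) = X" if "X \<in> carrier_mat n n" for X
  proof -
    have "?Z * (minv ?Z * X) = ?Z * minv ?Z * X"
      using iZ(1) Z(1) that by (intro assoc_mult_mat[symmetric])
    then show ?thesis using iZ(2) that by simp
  qed
  have "S * ?Z * S * (?T * minv ?Z * ?T) = S * (?Z * (S * (?T * (minv ?Z * ?T))))"
    using S(1) iS(1) Z(1) iZ(1) by simp
  also have "\<dots> = 1\<^sub>m n"
    using iS S(1) iZ(1) by (simp add: cancel cancelZ del: of_real_diff)
  finally show ?thesis
    unfolding wharm_def e using S(1) iS(1) Z(1) iZ(1) by (intro minv_unique) auto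
qed

text \<open>The representation of \<open>f\<close> is applied to \<open>minv S * B * minv S\<close>.
  Congruence turns the integrand into \<open>minv S * wharm t A B * minv S\<close>, and the outer
  factors \<open>S\<close> of the mean cancel.\<close>

lemma matrix_mean_conv_integral:
  assumes A: "A \<in> carrier_mat n n" "accretive A" and B: "B \<in> carrier_mat n n" "accretive B"
    and \<nu>: "represents \<nu> f"
  shows "matrix_mean f A B = mat_integral n \<nu> (\<lambda>t. wharm t A B)"
proof -
  note [simp] = assoc_mult_mat[of _ n n _ n _ n]
  define S where "S = principal_sqrt A"
  have S: "S \<in> carrier_mat n n" "S * S = A"
    unfolding S_def using principal_sqrt_facts[OF A(1) accretive_slit_spectrum[OF A]] by auto
  have d: "Determinant.det S \<noteq> 0"
    using accretive_det_nonzero[OF A] det_mult[OF S(1) S(1)] S(2) by auto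
  note iS = minv_inverse[OF S(1) d]
  let ?T = "minv S"
  let ?X = "?T * B * ?T"
  have X: "?X \<in> carrier_mat n n" using iS B by auto
  have cancel: "S * (?T * Y) = Y" "?T * (S * Y) = Y" if "Y \<in> carrier_mat n n" for Y
    using iS S(1) that by (simp_all flip: assoc_mult_mat[of _ n n _ n _ n])
  \<comment> \<open>The formula in \<open>represents\<close> is available only for spectra off the
    cut.\<close>
  have "slit_spectrum ?X"
  proof (rule slit_spectrum_generalized[OF A X B])
    fix k v assume v: "v \<in> carrier_vec n" "v \<noteq> 0\<^sub>v n" "?X *\<^sub>v v = k \<cdot>\<^sub>v v"
    \<comment> \<open>This turns an eigenvector of \<open>?X\<close> into a solution of
      \<open>B w = k A w\<close>, since \<open>S * ?X = B * ?T\<close> and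
      \<open>A = S * S\<close>.\<close>
    define w where "w = ?T *\<^sub>v v"
    have w: "w \<in> carrier_vec n" "S *\<^sub>v w = v"
      unfolding w_def using minv_mult_vec[OF S(1) d v(1)] by auto
    have "w \<noteq> 0\<^sub>v n" using w(2) v(2) S(1) by auto
    moreover have "B *\<^sub>v w = k \<cdot>\<^sub>v (A *\<^sub>v w)"
    proof -
      have "S * ?X = B * ?T" using cancel[of "B * ?T"] iS B S(1) by simp
      then have "B *\<^sub>v w = (S * ?X) *\<^sub>v v"
        unfolding w_def using B iS v(1) by (simp add: assoc_mult_mat_vec[of _ n n _ n])
      also have "\<dots> = S *\<^sub>v (?X *\<^sub>v v)" using S(1) X v(1) by (rule assoc_mult_mat_vec)
      also have "\<dots> = k \<cdot>\<^sub>v (S *\<^sub>v v)" unfolding v(3) using S(1) v(1) by (rule mult_mat_vec)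
      also have "S *\<^sub>v v = A *\<^sub>v w"
        unfolding S(2)[symmetric] using S(1) w by (simp add: assoc_mult_mat_vec[of _ n n _ n])
      finally show ?thesis .
    qed
    ultimately show "\<exists>w\<in>carrier_vec n. w \<noteq> 0\<^sub>v n \<and> B *\<^sub>v w = k \<cdot>\<^sub>v (A *\<^sub>v w)" using w by blast
  qed
  then have h: "hol_fun (analytic_ext f) ?X = mat_integral n \<nu> (\<lambda>t. wharm t (1\<^sub>m n) ?X)"
    using \<nu> X unfolding represents_def by blast
  have fin: "finite_measure \<nu>" and sets: "sets \<nu> = sets (restrict_space borel {0..1})"
    using \<nu> unfolding represents_def prob_space_def by auto
  have space: "space \<nu> = {0..1}"
    using sets_eq_imp_space_eq[OF sets] by (simp add: space_restrict_space)
  have W: "integrable_entries n \<nu> (\<lambda>t. wharm t A B)"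
    "\<And>t. t \<in> space \<nu> \<Longrightarrow> wharm t A B \<in> carrier_mat n n"
    using continuous_entries_integrable[OF fin sets continuous_entries_wharm[OF A B]]
      wharm_carrier[OF A B] space by auto
  have "mat_integral n \<nu> (\<lambda>t. wharm t (1\<^sub>m n) ?X) = mat_integral n \<nu> (\<lambda>t. ?T * wharm t A B * ?T)"
    using wharm_congruence[OF S A B] space by (intro mat_integral_cong) auto
  also have "\<dots> = ?T * mat_integral n \<nu> (\<lambda>t. wharm t A B) * ?T"
    using mat_integral_mult[OF W iS(1) iS(1)] by simp
  finally have "matrix_mean f A B = S * (?T * mat_integral n \<nu> (\<lambda>t. wharm t A B) * ?T) * S"
    unfolding matrix_mean_def Let_def S_def[symmetric] h by simp
  also have "\<dots> = S * (?T * (mat_integral n \<nu> (\<lambda>t. wharm t A B) * (?T * S)))"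
    using S(1) iS(1) mat_integral_carrier[of n \<nu> "\<lambda>t. wharm t A B"]
    by (simp del: mat_integral_carrier)
  also have "\<dots> = mat_integral n \<nu> (\<lambda>t. wharm t A B)"
    unfolding iS(3) right_mult_one_mat[OF mat_integral_carrier] using cancel(1)[OF mat_integral_carrier[of n \<nu> "\<lambda>t. wharm t A B"]] by simp
  finally show ?thesis .
qed

section \<open>The refined pointwise inequality\<close>

text \<open>Jensen's inequality at \<open>t \<le> 1 / 2\<close> for the nodes \<open>X\<close> and \<open>(X + Y) / 2\<close>, with the roles of
  \<open>X\<close> and \<open>Y\<close> exchanged for \<open>t \<ge> 1 / 2\<close>.\<close>

lemma qform_inv_Re_inv_refined:
  assumes X: "X \<in> carrier_mat n n" "accretive X" and Y: "Y \<in> carrier_mat n n" "accretive Y"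
    and t: "0 \<le> t" "t \<le> 1" and v: "v \<in> carrier_vec n"
  defines "Z \<equiv> \<lambda>s. complex_of_real (1 - s) \<cdot>\<^sub>m X + complex_of_real s \<cdot>\<^sub>m Y"
    and "q \<equiv> \<lambda>W. qform (inv_Re_inv W) v"
  shows "q (Z t) \<le> (1 - t) * q X + t * q Y
    - 2 * min t (1 - t) * ((q X + q Y) / 2 - q (Z (1 / 2)))"
proof -
  have H: "Z (1 / 2) \<in> carrier_mat n n" "accretive (Z (1 / 2))"
    unfolding Z_def using X Y accretive_convex[OF X Y, of "1/2"] by auto
  show ?thesis
  proof (cases "t \<le> 1 / 2")
    case True
    have "Z t = complex_of_real (1 - 2 * t) \<cdot>\<^sub>m X + complex_of_real (2 * t) \<cdot>\<^sub>m Z (1 / 2)"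
      unfolding Z_def using X Y by (intro eq_matI) (auto simp: algebra_simps)
    then have "q (Z t) \<le> (1 - 2 * t) * q X + 2 * t * q (Z (1 / 2))"
      unfolding q_def using qform_inv_Re_inv_convex[OF X H _ _ v, of "2 * t"] t True by simp
    then show ?thesis using True by (simp add: field_simps)
  next
    case False
    have "Z t = complex_of_real (1 - (2 * t - 1)) \<cdot>\<^sub>m Z (1 / 2) + complex_of_real (2 * t - 1) \<cdot>\<^sub>m Y"
      unfolding Z_def using X Y by (intro eq_matI) (auto simp: algebra_simps)
    then have "q (Z t) \<le> (1 - (2 * t - 1)) * q (Z (1 / 2)) + (2 * t - 1) * q Y"
      unfolding q_def using qform_inv_Re_inv_convex[OF H Y _ _ v, of "2 * t - 1"] t False by simp
    then show ?thesis using False by (simp add: min_def field_simps)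
  qed
qed

text \<open>The integrand of the theorem before its outer inversion; bounds are proved at this level
  and then reversed by inverting.\<close>

definition refined_inverse :: "complex mat \<Rightarrow> complex mat \<Rightarrow> real \<Rightarrow> complex mat" where
  "refined_inverse A B t = minv (wharm t (Re_mat A) (Re_mat B))
    - complex_of_real (2 * min t (1 - t)) \<cdot>\<^sub>m
        (minv (hmean (Re_mat A) (Re_mat B)) - minv (Re_mat (hmean A B)))"

lemma minv_wharm:
  assumes "A \<in> carrier_mat n n" "accretive A" "B \<in> carrier_mat n n" "accretive B"
    and "0 \<le> t" "t \<le> 1"
  shows "minv (wharm t A B) = complex_of_real (1 - t) \<cdot>\<^sub>m minv A + complex_of_real t \<cdot>\<^sub>m minv B"
  unfolding wharm_def using wharm_inverse_facts[OF assms] by (intro minv_minv accretive_det_nonzero)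

lemma hermitian_minv_wharm:
  assumes A: "A \<in> carrier_mat n n" "accretive A" "hermitian_mat A"
    and B: "B \<in> carrier_mat n n" "accretive B" "hermitian_mat B" and t: "0 \<le> t" "t \<le> 1"
  shows "minv (wharm t A B) \<in> carrier_mat n n" "hermitian_mat (minv (wharm t A B))"
proof -
  have c: "minv A \<in> carrier_mat n n" "minv B \<in> carrier_mat n n"
    using accretive_minv_carrier A B by auto
  moreover have "hermitian_mat (minv A)" "hermitian_mat (minv B)"
    using hermitian_minv accretive_det_nonzero A B by auto
  ultimately show "minv (wharm t A B) \<in> carrier_mat n n" "hermitian_mat (minv (wharm t A B))"
    unfolding minv_wharm[OF A(1,2) B(1,2) t]
    by (auto intro!: hermitian_add[of _ n] hermitian_smult[of _ n] simp del: of_real_diff)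
qed

text \<open>In terms of forms, \<open>inv_Re_inv (Z t) \<le> N \<le> W t\<close>: the left bound is
  the refined Jensen inequality, the right one holds because the midpoint gap \<open>D\<close> is
  nonnegative. Inversion reverses both.\<close>

lemma wharm_refined_bounds:
  assumes A: "A \<in> carrier_mat n n" "accretive A" and B: "B \<in> carrier_mat n n" "accretive B"
    and t: "0 \<le> t" "t \<le> 1"
  defines "N \<equiv> refined_inverse A B t"
  shows "N \<in> carrier_mat n n" "hermitian_mat N" "accretive N"
    and "\<And>v. v \<in> carrier_vec n \<Longrightarrow> qform (minv N) v \<le> qform (wharm t A B) v"
    and "\<And>v. v \<in> carrier_vec n \<Longrightarrow> qform (wharm t (Re_mat A) (Re_mat B)) v \<le> qform (minv N) v"
proof -
  define a b X Y where "a = Re_mat A" and "b = Re_mat B" and "X = minv A" and "Y = minv B"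
  define Z where "Z s = complex_of_real (1 - s) \<cdot>\<^sub>m X + complex_of_real s \<cdot>\<^sub>m Y" for s
  have a: "a \<in> carrier_mat n n" "accretive a" "hermitian_mat a"
    and b: "b \<in> carrier_mat n n" "accretive b" "hermitian_mat b"
    unfolding a_def b_def using A B by (auto intro: accretive_Re_mat hermitian_Re_mat)
  have X: "X \<in> carrier_mat n n" "accretive X" and Y: "Y \<in> carrier_mat n n" "accretive Y"
    unfolding X_def Y_def using A B by (auto intro: accretive_minv_carrier accretive_minv)
  have Z: "Z s \<in> carrier_mat n n" "accretive (Z s)" if "0 \<le> s" "s \<le> 1" for s
    unfolding Z_def X_def Y_def using wharm_inverse_facts[OF A B that] by auto
  have wharm_Z: "wharm s A B = minv (Z s)" for s unfolding wharm_def Z_def X_def Y_def ..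
  \<comment> \<open>\<open>minv X\<close> is \<open>A\<close> again, so at the two nodes \<phi>
    gives the inverses of the real parts.\<close>
  have inv_a: "inv_Re_inv X = minv a" and inv_b: "inv_Re_inv Y = minv b"
    unfolding inv_Re_inv_def X_def Y_def a_def b_def
    using minv_minv accretive_det_nonzero A B by auto
  define W where "W s = minv (wharm s a b)" for s
  have W: "W s \<in> carrier_mat n n" "hermitian_mat (W s)" if "0 \<le> s" "s \<le> 1" for s
    unfolding W_def using hermitian_minv_wharm[OF a b that] by auto
  note H = Z[of "1/2"]
  define D where "D = W (1 / 2) - inv_Re_inv (Z (1 / 2))"
  have D: "D \<in> carrier_mat n n" "hermitian_mat D"
    unfolding D_def using W[of "1/2"] inv_Re_inv_facts[OF Z, of "1/2"]
    by (auto intro: hermitian_diff minus_carrier_mat)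
  have N_eq: "N = W t - complex_of_real (2 * min t (1 - t)) \<cdot>\<^sub>m D"
    unfolding N_def refined_inverse_def D_def W_def a_def b_def wharm_Z inv_Re_inv_def ..
  have cD: "complex_of_real (2 * min t (1 - t)) \<cdot>\<^sub>m D \<in> carrier_mat n n"
    using D by auto
  show N: "N \<in> carrier_mat n n" "hermitian_mat N"
    unfolding N_eq
    using minus_carrier_mat[OF cD] hermitian_diff[OF W(1)[OF t] cD W(2)[OF t] hermitian_smult[OF D]] .
  \<comment> \<open>\<open>W s\<close> interpolates linearly between the values of \<phi> at
    \<open>X\<close> and \<open>Y\<close>, which makes \<open>D\<close> the convexity gap at the
    midpoint.\<close>
  have qW: "qform (W s) v = (1 - s) * qform (inv_Re_inv X) v + s * qform (inv_Re_inv Y) v"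
    if "0 \<le> s" "s \<le> 1" "v \<in> carrier_vec n" for s v
  proof -
    have "minv a \<in> carrier_mat n n" "minv b \<in> carrier_mat n n"
      using accretive_minv_carrier a b by auto
    then show ?thesis
      unfolding W_def minv_wharm[OF a(1,2) b(1,2) that(1,2)] inv_a inv_b using that(3)
      by (simp add: qform_add[of _ n] qform_smult[of _ n] del: of_real_diff)
  qed
  have qD: "qform D v = (qform (inv_Re_inv X) v + qform (inv_Re_inv Y) v) / 2
      - qform (inv_Re_inv (Z (1 / 2))) v" if "v \<in> carrier_vec n" for v
    using that W[of "1/2"] inv_Re_inv_facts(1)[OF Z, of "1/2"] qW[of "1/2" v]
    unfolding D_def by (simp add: qform_diff[of _ n])
  have qN: "qform N v = qform (W t) v - 2 * min t (1 - t) * qform D v" if "v \<in> carrier_vec n" for v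
    unfolding N_eq using qform_diff[OF W(1)[OF t] cD that] qform_smult[OF D(1) that] by (simp del: of_real_mult)
  have lower: "qform (inv_Re_inv (Z t)) v \<le> qform N v" if v: "v \<in> carrier_vec n" for v
    using qform_inv_Re_inv_refined[OF X Y t v] unfolding qN[OF v] qD[OF v] qW[OF t v] Z_def .
  have upper: "qform N v \<le> qform (W t) v" if v: "v \<in> carrier_vec n" for v
  proof -
    have "0 \<le> qform D v"
      using qform_inv_Re_inv_convex[OF X Y _ _ v, of "1/2"] unfolding qD[OF v] Z_def by simp
    then show ?thesis using t unfolding qN[OF v] by simp
  qed
  note F = inv_Re_inv_facts[OF Z[OF t]]
  \<comment> \<open>A lower bound by an accretive matrix forces \<open>N\<close> to be accretive, so
    \<open>minv N\<close> is a genuine inverse.\<close>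
  show N_acc: "accretive N"
    using lower F accretive_iff[OF F(1)] accretive_iff[OF N(1)] by (meson less_le_trans)
  \<comment> \<open>The outer inversion undoes the one in \<phi>, leaving the real part of the
    harmonic mean.\<close>
  have "minv (inv_Re_inv (Z t)) = Re_mat (wharm t A B)"
    unfolding inv_Re_inv_def wharm_Z
    using Re_mat_minv_facts[OF Z[OF t]] by (intro minv_minv accretive_det_nonzero)
  then show "qform (minv N) v \<le> qform (wharm t A B) v" if "v \<in> carrier_vec n" for v
    using qform_minv_antimono[OF F N(1) N_acc lower that] qform_Re_mat[OF wharm_carrier[OF A B t] that]
    by simp
  have W_acc: "accretive (W t)"
    using upper N_acc accretive_iff[OF W(1)[OF t]] accretive_iff[OF N(1)] by (meson less_le_trans)
  have "minv (W t) = wharm t a b"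
    unfolding W_def wharm_def using wharm_inverse_facts[OF a(1,2) b(1,2) t]
    by (simp add: minv_minv[of _ n] accretive_det_nonzero[of _ n] del: of_real_diff)
  then show "qform (wharm t (Re_mat A) (Re_mat B)) v \<le> qform (minv N) v" if "v \<in> carrier_vec n" for v
    using qform_minv_antimono[OF N N_acc W(1)[OF t] W_acc upper that] unfolding a_def b_def by simp
qed

text \<open>The bracketed difference is constant in \<open>t\<close>; only its scalar factor and the
  inverse of the weighted mean vary, both continuously.\<close>

lemma continuous_entries_refined_inverse:
  assumes A: "A \<in> carrier_mat n n" "accretive A" and B: "B \<in> carrier_mat n n" "accretive B"
  shows "continuous_entries n {0..1} (refined_inverse A B)"
proof -
  define a b where "a = Re_mat A" and "b = Re_mat B"
  have a: "a \<in> carrier_mat n n" "accretive a" "hermitian_mat a"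
    and b: "b \<in> carrier_mat n n" "accretive b" "hermitian_mat b"
    unfolding a_def b_def using A B by (auto intro: accretive_Re_mat hermitian_Re_mat)
  have W: "continuous_entries n {0..1} (\<lambda>t. minv (wharm t a b))"
  proof (rule continuous_entries_minv[OF continuous_entries_wharm[OF a(1,2) b(1,2)]])
    fix t :: real assume "t \<in> {0..1}"
    then have Z: "complex_of_real (1 - t) \<cdot>\<^sub>m minv a + complex_of_real t \<cdot>\<^sub>m minv b \<in> carrier_mat n n"
      "accretive (complex_of_real (1 - t) \<cdot>\<^sub>m minv a + complex_of_real t \<cdot>\<^sub>m minv b)"
      using wharm_inverse_facts[OF a(1,2) b(1,2), of t] by auto
    then show "Determinant.det (wharm t a b) \<noteq> 0"
      unfolding wharm_def by (intro det_minv_nonzero[OF Z(1)] accretive_det_nonzero[OF Z])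
  qed
  have "minv (hmean a b) \<in> carrier_mat n n"
    using hermitian_minv_wharm[OF a b] by simp
  moreover have "minv (Re_mat (hmean A B)) \<in> carrier_mat n n"
  proof -
    have "complex_of_real (1 - 1 / 2) \<cdot>\<^sub>m minv A + complex_of_real (1 / 2) \<cdot>\<^sub>m minv B \<in> carrier_mat n n"
      "accretive (complex_of_real (1 - 1 / 2) \<cdot>\<^sub>m minv A + complex_of_real (1 / 2) \<cdot>\<^sub>m minv B)"
      using wharm_inverse_facts[OF A B, of "1/2"] by auto
    from inv_Re_inv_facts(1)[OF this] show ?thesis unfolding inv_Re_inv_def wharm_def .
  qed
  ultimately show ?thesis
    unfolding refined_inverse_def[abs_def] a_def[symmetric] b_def[symmetric]
    by (intro continuous_entries_diff[OF W] continuous_entries_smult continuous_entries_const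
        continuous_intros minus_carrier_mat)
qed

section \<open>Integration of the pointwise bounds over \<nu>\<close>

theorem corollary2p1:
  fixes n :: nat and A B :: "complex mat" and f :: "real \<Rightarrow> real" and \<nu> :: "real measure"
  assumes "n \<ge> 1"
    and "A \<in> carrier_mat n n" and "B \<in> carrier_mat n n"
    and "accretive A" and "accretive B"
    and "\<And>x. x > 0 \<Longrightarrow> f x > 0" and "f 1 = 1" and "matrix_monotone f"
    and "represents \<nu> f"
  defines "M \<equiv> mat_integral n \<nu> (\<lambda>t.
      minv (minv (wharm t (Re_mat A) (Re_mat B))
        - complex_of_real (2 * min t (1 - t)) \<cdot>\<^sub>m
            (minv (hmean (Re_mat A) (Re_mat B)) - minv (Re_mat (hmean A B)))))"
  shows "M \<le>\<^sub>L Re_mat (matrix_mean f A B) \<and> matrix_mean f (Re_mat A) (Re_mat B) \<le>\<^sub>L M"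
proof -
  note A = assms(2,4) and B = assms(3,5) and \<nu> = assms(9)
  have M: "M = mat_integral n \<nu> (\<lambda>t. minv (refined_inverse A B t))"
    unfolding M_def refined_inverse_def ..
  have a: "Re_mat A \<in> carrier_mat n n" "accretive (Re_mat A)" "hermitian_mat (Re_mat A)"
    and b: "Re_mat B \<in> carrier_mat n n" "accretive (Re_mat B)" "hermitian_mat (Re_mat B)"
    using A B by (auto intro: accretive_Re_mat hermitian_Re_mat)
  have fin: "finite_measure \<nu>" and sets: "sets \<nu> = sets (restrict_space borel {0..1})"
    using \<nu> unfolding represents_def prob_space_def by auto
  have "space \<nu> = {0..1}"
    using sets_eq_imp_space_eq[OF sets] by (simp add: space_restrict_space)
  then have t: "0 \<le> t" "t \<le> 1" if "t \<in> space \<nu>" for t using that by auto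
  note int = continuous_entries_integrable[OF fin sets]
  note mean = matrix_mean_conv_integral[OF A B \<nu>]
    and mean_Re = matrix_mean_conv_integral[OF a(1,2) b(1,2) \<nu>]
  \<comment> \<open>\<open>t\<close> names two facts with the same premise, so instances of
    \<open>bounds\<close> ask for membership in \<open>space \<nu>\<close> twice.\<close>
  note bounds = wharm_refined_bounds[OF A B t]
  have det_N: "Determinant.det (refined_inverse A B t) \<noteq> 0" if "t \<in> space \<nu>" for t
    using accretive_det_nonzero[OF bounds(1,3)[OF that that]] .
  have N: "minv (refined_inverse A B t) \<in> carrier_mat n n"
    "hermitian_mat (minv (refined_inverse A B t))" if "t \<in> space \<nu>" for t
    using minv_inverse(1)[OF bounds(1)[OF that that] det_N[OF that]]
      hermitian_minv[OF bounds(1)[OF that that] det_N[OF that] bounds(2)[OF that that]] .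
  have wharm_herm: "hermitian_mat (wharm t (Re_mat A) (Re_mat B))" if "t \<in> space \<nu>" for t
  proof -
    note c = wharm_inverse_facts[OF a(1,2) b(1,2) t[OF that]]
    \<comment> \<open>The mean is the inverse of its own inverse, which is already known to be
      Hermitian.\<close>
    have "wharm t (Re_mat A) (Re_mat B) = minv (minv (wharm t (Re_mat A) (Re_mat B)))"
      unfolding wharm_def using minv_minv[OF c(1) accretive_det_nonzero[OF c]] by simp
    moreover have "accretive (minv (wharm t (Re_mat A) (Re_mat B)))"
      using c(2) minv_wharm[OF a(1,2) b(1,2) t[OF that]] by simp
    ultimately show ?thesis
      using hermitian_minv_wharm[OF a b t[OF that]] hermitian_minv accretive_det_nonzero by metis
  qed
  have int_N: "integrable_entries n \<nu> (\<lambda>t. minv (refined_inverse A B t))"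
    using det_N \<open>space \<nu> = {0..1}\<close>
    by (intro int continuous_entries_minv continuous_entries_refined_inverse A B) auto
  have int_W: "integrable_entries n \<nu> (\<lambda>t. wharm t A B)"
    "integrable_entries n \<nu> (\<lambda>t. wharm t (Re_mat A) (Re_mat B))"
    using int continuous_entries_wharm A B a b by auto
  have herm: "hermitian_mat M" "hermitian_mat (matrix_mean f (Re_mat A) (Re_mat B))"
    unfolding M mean_Re using N wharm_herm wharm_carrier[OF a(1,2) b(1,2)] t
    by (auto intro: hermitian_mat_integral)
  \<comment> \<open>The mean and its Hermitian part have the same form, so it suffices to compare
    with the integral of \<open>wharm t A B\<close> itself.\<close>
  have "qform M v \<le> qform (Re_mat (matrix_mean f A B)) v" if v: "v \<in> carrier_vec n" for v
  proof -
    have "qform M v \<le> qform (mat_integral n \<nu> (\<lambda>t. wharm t A B)) v"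
      unfolding M using int_N N int_W v t bounds(4) wharm_carrier[OF A B]
      by (intro mat_integral_mono) auto
    then show ?thesis unfolding mean using v by (simp add: qform_Re_mat[of _ n])
  qed
  moreover have "qform (matrix_mean f (Re_mat A) (Re_mat B)) v \<le> qform M v"
    if v: "v \<in> carrier_vec n" for v
    unfolding M mean_Re using int_N N int_W v t bounds(5) wharm_carrier[OF a(1,2) b(1,2)]
    by (intro mat_integral_mono) auto
  moreover have "M \<in> carrier_mat n n" "matrix_mean f A B \<in> carrier_mat n n"
    "matrix_mean f (Re_mat A) (Re_mat B) \<in> carrier_mat n n"
    unfolding M mean mean_Re by auto
  ultimately show ?thesis
    using herm hermitian_Re_mat by (simp add: loewner_le_iff[of _ n])
qed

end
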